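(* Assume that for every $\theta\in\Theta$, $Q_\theta=(q_{ij}(\theta))_{1\le i,j\le N}$ is a real matrix with $q_{ij}(\theta)\ge0$ for $i\neq j$ and $q_{ii}(\theta)=-\sum_{j\ne i}q_{ij}(\theta)$, and that there exists $L_Q>0$ with $\|Q_\theta^*-Q_{\bar\theta}^*\|_{1\to1}\le L_Q|\theta-\bar\theta|$ for all $\theta,\bar\theta\in\Theta$. Assume that there exist a distinguished state $k_*\in S=\{1,\dots,N\}$ and a constant $\underline q_*>0$ such that $$q_{ik_*}(\theta)\ge\underline q_*\qquad\text{for all }\theta\in\Theta\text{ and all }i\ne k_* .$$ Define $$\overline q:=\sup_{\theta\in\Theta}\max_{1\le i\le N}\sum_{j\ne i}q_{ij}(\theta),\qquad \tau_*:=\underline q_*^{-1},\qquad \alpha_*:=e^{-\overline q/\underline q_*}.$$ Then, for every measurable path $\vartheta:[0,\infty)\to\Theta$, every $\delta>0$, and every $s\ge0$, each column of $P_\vartheta^\delta(s+\delta\tau_*,s)$ dominates $\alpha_*e_{k_*}$ entrywise, where $P_\vartheta^\delta(t,s)$ denotes the evolution operator on $\mathbb{R}^N$ for $\delta\dot p(t)=Q_{\vartheta(t)}^*p(t)$. Consequently, the following pathwise stability condition holds: there exist $C_{\mathrm{mix}}\ge1$, $\gamma>0$ with $|e^{tQ_\theta^*}\xi|_1\le C_{\mathrm{mix}}e^{-\gamma t}|\xi|_1$ for all $\theta\in\Theta$, $\xi\in\mathcal{Z}$, $t\ge0$, and there exist constants $C_{\mathrm{path}}\ge1$, $\gamma_{\mathrm{path}}>0$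 such that, for every $\delta>0$ and every measurable path $\vartheta:[0,\infty)\to\Theta$, the evolution family $U_\vartheta^\delta(t,s):\mathcal{Z}\to\mathcal{Z}$ of $\delta\dot\xi(t)=Q_{\vartheta(t)}^*\xi(t)$, $\xi(s)=\xi_s\in\mathcal{Z}$, satisfies $$|U_\vartheta^\delta(t,s)\xi|_1\le C_{\mathrm{path}}e^{-\gamma_{\mathrm{path}}(t-s)/\delta}|\xi|_1\qquad\text{for all }\xi\in\mathcal{Z},\ 0\le s\le t.$$ More precisely, if $N\ge2$, then the last estimate holds with $$C_{\mathrm{path}}:=(1-\alpha_* )^{-1},\qquad \gamma_{\mathrm{path}}:=\underline q_*\log\Bigl(\frac{1}{1-\alpha_*}\Bigr).$$ If $N=1$, then $\mathcal{Z}=\{0\}$ and the condition is trivial.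
   Context: $N,d\ge1$ are integers, $R_\theta>0$ is a constant (the subscript is part of its name), and $\Theta=[-R_\theta,R_\theta]^d$. $\mathcal{Z}=\{\xi\in\mathbb{R}^N:\sum_{i=1}^N\xi_i=0\}$. $e_1,\dots,e_N$ are the standard basis vectors of $\mathbb{R}^N$. $Q_\theta^*$ is the transpose of $Q_\theta$, acting on column vectors. $|\cdot|_1$ is the $\ell^1$-norm on $\mathbb{R}^N$, $\|\cdot\|_{1\to1}$ the induced operator norm, and $|\cdot|$ the Euclidean norm on $\mathbb{R}^d$. Solutions of the non-autonomous linear equation along a measurable path are absolutely continuous functions satisfying the equation almost everywhere (Carathéodory solutions). $P_\vartheta^\delta(t,s)$ is the matrix mapping $p(s)\in\mathbb{R}^N$ to $p(t)$, for $t\ge s\ge 0$, and $U_\vartheta^\delta(t,s)$ is the corresponding evolution operator on the subspace $\mathcal{Z}$, i.e. the restriction of $P_\vartheta^\delta(t,s)$ to $\mathcal{Z}$. *)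

theory Defs
  imports "HOL-Analysis.Analysis"
begin

section \<open>Rate matrices\<close>

definition param_cube :: "real \<Rightarrow> (real ^ 'd) set" where
  "param_cube R = {\<theta>. \<forall>i. - R \<le> \<theta> $ i \<and> \<theta> $ i \<le> R}"

definition rate_matrix :: "real ^ 'n ^ 'n \<Rightarrow> bool" where
  "rate_matrix A \<longleftrightarrow>
     (\<forall>i j. i \<noteq> j \<longrightarrow> 0 \<le> A $ i $ j) \<and>
     (\<forall>i. A $ i $ i = - (\<Sum>j\<in>UNIV - {i}. A $ i $ j))"

definition zero_sum :: "(real ^ 'n) set" where
  "zero_sum = {\<xi>. (\<Sum>i\<in>UNIV. \<xi> $ i) = 0}"

definition norm1 :: "real ^ 'n \<Rightarrow> real" where
  "norm1 x = (\<Sum>i\<in>UNIV. \<bar>x $ i\<bar>)"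

text \<open>The operator norm induced by the 1-norm, defined in the same way as
  \<^const>\<open>onorm\<close>, which is induced by the Euclidean norm.\<close>

definition opnorm1 :: "real ^ 'n ^ 'n \<Rightarrow> real" where
  "opnorm1 A = (SUP x. norm1 (A *v x) / norm1 x)"

definition max_exit_rate :: "(real ^ 'd) set \<Rightarrow> (real ^ 'd \<Rightarrow> real ^ 'n ^ 'n) \<Rightarrow> real" where
  "max_exit_rate \<Theta> Q =
     (SUP \<theta>\<in>\<Theta>. Max (range (\<lambda>i. \<Sum>j\<in>UNIV - {i}. Q \<theta> $ i $ j)))"


section \<open>Matrix exponential\<close>

text \<open>The type class multiplication on vectors of vectors is componentwise, so powers
  have to be formed explicitly with the matrix product.\<close>

definition matrix_exp :: "real ^ 'n ^ 'n \<Rightarrow> real ^ 'n ^ 'n" where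
  "matrix_exp A = (\<Sum>k. (1 / fact k) *\<^sub>R (((**) A ^^ k) (mat 1)))"


section \<open>Caratheodory solutions and the evolution family\<close>

text \<open>A finite family of non-overlapping subintervals is a finite set of pairs of endpoints.\<close>

definition abs_continuous_on_interval ::
    "real \<Rightarrow> real \<Rightarrow> (real \<Rightarrow> 'a::real_normed_vector) \<Rightarrow> bool" where
  "abs_continuous_on_interval a b f \<longleftrightarrow>
     (\<forall>\<epsilon>>0. \<exists>\<eta>>0. \<forall>D.
        finite D \<longrightarrow>
        (\<forall>(x, y)\<in>D. a \<le> x \<and> x \<le> y \<and> y \<le> b) \<longrightarrow>
        disjoint_family_on (\<lambda>(x, y). {x<..<y}) D \<longrightarrow>
        (\<Sum>(x, y)\<in>D. y - x) < \<eta> \<longrightarrow>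
        (\<Sum>(x, y)\<in>D. norm (f y - f x)) < \<epsilon>)"

text \<open>Paths are functions on the nonnegative half-line; their values at negative times play no
  role. Measurability is Lebesgue measurability, which includes all Borel paths.\<close>

definition measurable_path :: "(real ^ 'd) set \<Rightarrow> (real \<Rightarrow> real ^ 'd) \<Rightarrow> bool" where
  "measurable_path \<Theta> \<phi> \<longleftrightarrow>
     \<phi> \<in> borel_measurable (lebesgue_on {0..}) \<and> (\<forall>t\<ge>0. \<phi> t \<in> \<Theta>)"

definition caratheodory_solution ::
    "(real ^ 'd \<Rightarrow> real ^ 'n ^ 'n) \<Rightarrow> real \<Rightarrow> (real \<Rightarrow> real ^ 'd) \<Rightarrow>
     real \<Rightarrow> real \<Rightarrow> (real \<Rightarrow> real ^ 'n) \<Rightarrow> bool" where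
  "caratheodory_solution Q \<delta> \<phi> s t p \<longleftrightarrow>
     abs_continuous_on_interval s t p \<and>
     (AE r in lebesgue. r \<in> {s..t} \<longrightarrow>
        (\<exists>v. (p has_vector_derivative v) (at r) \<and> \<delta> *\<^sub>R v = transpose (Q (\<phi> r)) *v p r))"

text \<open>The matrix that maps \<open>p s\<close> to \<open>p t\<close> for every solution \<open>p\<close> on \<open>[s, t]\<close>; it is only
  meaningful for \<open>0 \<le> s \<le> t\<close>. It is unique because solutions exist for all
  initial values.\<close>

definition evolution_matrix ::
    "(real ^ 'd \<Rightarrow> real ^ 'n ^ 'n) \<Rightarrow> real \<Rightarrow> (real \<Rightarrow> real ^ 'd) \<Rightarrow>
     real \<Rightarrow> real \<Rightarrow> real ^ 'n ^ 'n" where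
  "evolution_matrix Q \<delta> \<phi> t s =
     (THE M. \<forall>p. caratheodory_solution Q \<delta> \<phi> s t p \<longrightarrow> p t = M *v p s)"

definition evolution_zero_sum ::
    "(real ^ 'd \<Rightarrow> real ^ 'n ^ 'n) \<Rightarrow> real \<Rightarrow> (real \<Rightarrow> real ^ 'd) \<Rightarrow>
     real \<Rightarrow> real \<Rightarrow> real ^ 'n \<Rightarrow> real ^ 'n" where
  "evolution_zero_sum Q \<delta> \<phi> t s =
     restrict (\<lambda>\<xi>. evolution_matrix Q \<delta> \<phi> t s *v \<xi>) zero_sum"


section \<open>Stability\<close>

definition mixing_bound ::
    "(real ^ 'd) set \<Rightarrow> (real ^ 'd \<Rightarrow> real ^ 'n ^ 'n) \<Rightarrow> real \<Rightarrow> real \<Rightarrow> bool" where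
  "mixing_bound \<Theta> Q C \<gamma> \<longleftrightarrow>
     C \<ge> 1 \<and> \<gamma> > 0 \<and>
     (\<forall>\<theta>\<in>\<Theta>. \<forall>\<xi>\<in>zero_sum. \<forall>t\<ge>0.
        norm1 (matrix_exp (t *\<^sub>R transpose (Q \<theta>)) *v \<xi>) \<le> C * exp (- \<gamma> * t) * norm1 \<xi>)"

definition path_bound ::
    "(real ^ 'd) set \<Rightarrow> (real ^ 'd \<Rightarrow> real ^ 'n ^ 'n) \<Rightarrow> real \<Rightarrow> real \<Rightarrow> bool" where
  "path_bound \<Theta> Q C \<gamma> \<longleftrightarrow>
     C \<ge> 1 \<and> \<gamma> > 0 \<and>
     (\<forall>\<delta>>0. \<forall>\<phi>. measurable_path \<Theta> \<phi> \<longrightarrow>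
        (\<forall>s t. 0 \<le> s \<and> s \<le> t \<longrightarrow>
           evolution_zero_sum Q \<delta> \<phi> t s \<in> zero_sum \<rightarrow> zero_sum \<and>
           (\<forall>\<xi>\<in>zero_sum. norm1 (evolution_zero_sum Q \<delta> \<phi> t s \<xi>)
                            \<le> C * exp (- \<gamma> * (t - s) / \<delta>) * norm1 \<xi>)))"

definition pathwise_stable ::
    "(real ^ 'd) set \<Rightarrow> (real ^ 'd \<Rightarrow> real ^ 'n ^ 'n) \<Rightarrow> bool" where
  "pathwise_stable \<Theta> Q \<longleftrightarrow>
     (\<exists>C \<gamma>. mixing_bound \<Theta> Q C \<gamma>) \<and> (\<exists>C \<gamma>. path_bound \<Theta> Q C \<gamma>)"

end

(* The substitution r(t) = exp (q t / \<delta>) p(t) turns the forward equation into r' = B r with a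
   nonnegative matrix B; the Picard iterates increase, so a solution exists and r is entrywise
   nondecreasing. Uniqueness holds because an absolutely continuous function with a.e. derivative
   bounded by M is M-Lipschitz. A column of the evolution matrix that
   starts in state j therefore satisfies r_k' \<ge> (q_low / \<delta>) r_j(s) if j differs from k, and
   r_k \<ge> r_k(s) if j = k; after time \<delta> / q_low this gives p_k \<ge> exp (- q / q_low). Doeblin's
   argument converts the minorization into a contraction by 1 - \<alpha> of the 1-norm on zero-sum
   vectors over each time window of length \<delta> / q_low, and iteration gives the exponential
   bound. The matrix exponential is covered by constant paths. *)

theory Submission
  imports Defs
begin

section \<open>Absolutely continuous functions\<close>

text \<open>The path is only measurable, so the coefficients have no continuity in time, and
  \<open>evolution_matrix\<close> is a definite description: nothing can be said about its entries
  before solutions are known to exist for every initial value and to be unique. The shift by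
  \<open>q\<close> makes the diagonal nonnegative. Since the rows of a rate matrix sum to zero, it
  also gives every column of \<open>B\<close> the same sum \<open>q / \<delta>\<close>; the total
  mass of each Picard iterate therefore stays below an exponential, which keeps the increasing
  sequence bounded. The window \<open>\<delta> / q_low\<close> is the time in which an inflow of at
  least \<open>q_low / \<delta>\<close> accumulates to 1, the value with which \<open>r_k\<close>
  starts when the column begins in \<open>k\<close> itself. Both cases thus meet in the same bound,
  and undoing the substitution costs the factor \<open>exp (- q / q_low)\<close>. Rounding the
  number of windows down loses at most one contraction factor, hence the prefactor
  \<open>inverse (1 - \<alpha>)\<close>. The decay rate needs \<alpha> < 1, which for at least two
  states follows from \<open>q_bar\<close> \<ge> \<open>q_low\<close> > 0.\<close>

lemma abs_continuous_on_intervalD: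
  assumes "abs_continuous_on_interval a b f" "\<epsilon> > 0"
  obtains \<eta> where "\<eta> > 0"
    "\<And>D. \<lbrakk>finite D; \<And>x y. (x, y) \<in> D \<Longrightarrow> a \<le> x \<and> x \<le> y \<and> y \<le> b;
        disjoint_family_on (\<lambda>(x, y). {x<..<y}) D; (\<Sum>(x, y)\<in>D. y - x) < \<eta>\<rbrakk>
        \<Longrightarrow> (\<Sum>(x, y)\<in>D. norm (f y - f x)) < \<epsilon>"
proof -
  obtain \<eta> where "\<eta> > 0" and \<eta>: "\<forall>D. finite D \<longrightarrow>
        (\<forall>(x, y)\<in>D. a \<le> x \<and> x \<le> y \<and> y \<le> b) \<longrightarrow>
        disjoint_family_on (\<lambda>(x, y). {x<..<y}) D \<longrightarrow>
        (\<Sum>(x, y)\<in>D. y - x) < \<eta> \<longrightarrow>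
        (\<Sum>(x, y)\<in>D. norm (f y - f x)) < \<epsilon>"
    using assms unfolding abs_continuous_on_interval_def by meson
  show thesis
    by (rule that[OF \<open>\<eta> > 0\<close>]) (use \<eta> in auto)
qed

lemma abs_continuous_on_interval_subset:
  assumes "abs_continuous_on_interval a b f" "a \<le> c" "d \<le> b"
  shows "abs_continuous_on_interval c d f"
  unfolding abs_continuous_on_interval_def
proof (intro allI impI)
  fix \<epsilon> :: real assume "\<epsilon> > 0"
  obtain \<eta> where \<eta>: "\<eta> > 0"
    "\<And>D. \<lbrakk>finite D; \<And>x y. (x, y) \<in> D \<Longrightarrow> a \<le> x \<and> x \<le> y \<and> y \<le> b;
        disjoint_family_on (\<lambda>(x, y). {x<..<y}) D; (\<Sum>(x, y)\<in>D. y - x) < \<eta>\<rbrakk>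
        \<Longrightarrow> (\<Sum>(x, y)\<in>D. norm (f y - f x)) < \<epsilon>"
    using abs_continuous_on_intervalD[OF assms(1) \<open>\<epsilon> > 0\<close>] by blast
  show "\<exists>\<eta>>0. \<forall>D. finite D \<longrightarrow> (\<forall>(x, y)\<in>D. c \<le> x \<and> x \<le> y \<and> y \<le> d) \<longrightarrow>
        disjoint_family_on (\<lambda>(x, y). {x<..<y}) D \<longrightarrow> (\<Sum>(x, y)\<in>D. y - x) < \<eta> \<longrightarrow>
        (\<Sum>(x, y)\<in>D. norm (f y - f x)) < \<epsilon>"
    by (intro exI[of _ \<eta>] conjI \<eta>(1) allI impI, rule \<eta>(2)) (use assms(2,3) in force)+
qed

lemma abs_continuous_on_interval_const: "abs_continuous_on_interval a b (\<lambda>x. c)"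
  by (auto simp: abs_continuous_on_interval_def intro!: exI[of _ 1])

lemma abs_continuous_on_interval_add:
  assumes "abs_continuous_on_interval a b f" "abs_continuous_on_interval a b g"
  shows "abs_continuous_on_interval a b (\<lambda>x. f x + g x)"
  unfolding abs_continuous_on_interval_def
proof (intro allI impI)
  fix \<epsilon> :: real assume "\<epsilon> > 0"
  then have e2: "\<epsilon> / 2 > 0" by simp
  obtain \<eta> where \<eta>: "\<eta> > 0"
    "\<And>D. \<lbrakk>finite D; \<And>x y. (x, y) \<in> D \<Longrightarrow> a \<le> x \<and> x \<le> y \<and> y \<le> b;
        disjoint_family_on (\<lambda>(x, y). {x<..<y}) D; (\<Sum>(x, y)\<in>D. y - x) < \<eta>\<rbrakk>
        \<Longrightarrow> (\<Sum>(x, y)\<in>D. norm (f y - f x)) < \<epsilon> / 2"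
    using abs_continuous_on_intervalD[OF assms(1) e2] by blast
  obtain \<eta>' where \<eta>': "\<eta>' > 0"
    "\<And>D. \<lbrakk>finite D; \<And>x y. (x, y) \<in> D \<Longrightarrow> a \<le> x \<and> x \<le> y \<and> y \<le> b;
        disjoint_family_on (\<lambda>(x, y). {x<..<y}) D; (\<Sum>(x, y)\<in>D. y - x) < \<eta>'\<rbrakk>
        \<Longrightarrow> (\<Sum>(x, y)\<in>D. norm (g y - g x)) < \<epsilon> / 2"
    using abs_continuous_on_intervalD[OF assms(2) e2] by blast
  show "\<exists>\<eta>>0. \<forall>D. finite D \<longrightarrow> (\<forall>(x, y)\<in>D. a \<le> x \<and> x \<le> y \<and> y \<le> b) \<longrightarrow>
        disjoint_family_on (\<lambda>(x, y). {x<..<y}) D \<longrightarrow> (\<Sum>(x, y)\<in>D. y - x) < \<eta> \<longrightarrow>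
        (\<Sum>(x, y)\<in>D. norm (f y + g y - (f x + g x))) < \<epsilon>"
  proof (intro exI[of _ "min \<eta> \<eta>'"] conjI allI impI)
    fix D :: "(real \<times> real) set"
    assume D: "finite D" "\<forall>(x, y)\<in>D. a \<le> x \<and> x \<le> y \<and> y \<le> b"
      "disjoint_family_on (\<lambda>(x, y). {x<..<y}) D" "(\<Sum>(x, y)\<in>D. y - x) < min \<eta> \<eta>'"
    have "(\<Sum>(x, y)\<in>D. norm (f y + g y - (f x + g x)))
        \<le> (\<Sum>(x, y)\<in>D. norm (f y - f x) + norm (g y - g x))"
      by (intro sum_mono) (auto simp: add_diff_add norm_triangle_ineq)
    also have "\<dots> = (\<Sum>(x, y)\<in>D. norm (f y - f x)) + (\<Sum>(x, y)\<in>D. norm (g y - g x))"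
      by (simp add: sum.distrib case_prod_unfold)
    also have "\<dots> < \<epsilon> / 2 + \<epsilon> / 2"
      by (intro add_strict_mono \<eta>(2) \<eta>'(2)) (use D in auto)
    finally show "(\<Sum>(x, y)\<in>D. norm (f y + g y - (f x + g x))) < \<epsilon>" by simp
  qed (use \<eta>(1) \<eta>'(1) in auto)
qed

lemma abs_continuous_on_interval_bounded_linear:
  assumes "abs_continuous_on_interval a b f" "bounded_linear h"
  shows "abs_continuous_on_interval a b (\<lambda>x. h (f x))"
  unfolding abs_continuous_on_interval_def
proof (intro allI impI)
  fix \<epsilon> :: real assume "\<epsilon> > 0"
  obtain K where K: "K > 0" "\<And>x. norm (h x) \<le> norm x * K"
    using bounded_linear.pos_bounded[OF assms(2)] by blast
  have eK: "\<epsilon> / K > 0" using K \<open>\<epsilon> > 0\<close> by simp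
  obtain \<eta> where \<eta>: "\<eta> > 0"
    "\<And>D. \<lbrakk>finite D; \<And>x y. (x, y) \<in> D \<Longrightarrow> a \<le> x \<and> x \<le> y \<and> y \<le> b;
        disjoint_family_on (\<lambda>(x, y). {x<..<y}) D; (\<Sum>(x, y)\<in>D. y - x) < \<eta>\<rbrakk>
        \<Longrightarrow> (\<Sum>(x, y)\<in>D. norm (f y - f x)) < \<epsilon> / K"
    using abs_continuous_on_intervalD[OF assms(1) eK] by blast
  show "\<exists>\<eta>>0. \<forall>D. finite D \<longrightarrow> (\<forall>(x, y)\<in>D. a \<le> x \<and> x \<le> y \<and> y \<le> b) \<longrightarrow>
        disjoint_family_on (\<lambda>(x, y). {x<..<y}) D \<longrightarrow> (\<Sum>(x, y)\<in>D. y - x) < \<eta> \<longrightarrow>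
        (\<Sum>(x, y)\<in>D. norm (h (f y) - h (f x))) < \<epsilon>"
  proof (intro exI[of _ \<eta>] conjI allI impI \<eta>(1))
    fix D :: "(real \<times> real) set"
    assume D: "finite D" "\<forall>(x, y)\<in>D. a \<le> x \<and> x \<le> y \<and> y \<le> b"
      "disjoint_family_on (\<lambda>(x, y). {x<..<y}) D" "(\<Sum>(x, y)\<in>D. y - x) < \<eta>"
    have "(\<Sum>(x, y)\<in>D. norm (h (f y) - h (f x))) \<le> (\<Sum>(x, y)\<in>D. norm (f y - f x) * K)"
      using K(2) by (intro sum_mono)
        (auto simp: linear_diff[OF bounded_linear.linear[OF assms(2)], symmetric])
    also have "\<dots> = (\<Sum>(x, y)\<in>D. norm (f y - f x)) * K"
      by (simp add: sum_distrib_right case_prod_unfold)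
    also have "\<dots> < \<epsilon> / K * K"
      by (intro mult_strict_right_mono \<eta>(2) K(1)) (use D in auto)
    finally show "(\<Sum>(x, y)\<in>D. norm (h (f y) - h (f x))) < \<epsilon>" using K(1) by simp
  qed
qed

lemma lipschitz_on_imp_abs_continuous_on_interval:
  assumes "C-lipschitz_on {a..b} f"
  shows "abs_continuous_on_interval a b f"
  unfolding abs_continuous_on_interval_def
proof (intro allI impI)
  fix \<epsilon> :: real assume "\<epsilon> > 0"
  have C: "C \<ge> 0" using assms lipschitz_on_nonneg by blast
  show "\<exists>\<eta>>0. \<forall>D. finite D \<longrightarrow> (\<forall>(x, y)\<in>D. a \<le> x \<and> x \<le> y \<and> y \<le> b) \<longrightarrow>
        disjoint_family_on (\<lambda>(x, y). {x<..<y}) D \<longrightarrow> (\<Sum>(x, y)\<in>D. y - x) < \<eta> \<longrightarrow>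
        (\<Sum>(x, y)\<in>D. norm (f y - f x)) < \<epsilon>"
  \<comment> \<open>Dividing by \<open>C + 1\<close> instead of \<open>C\<close> covers
    \<open>C = 0\<close>.\<close>
  proof (intro exI[of _ "\<epsilon> / (C + 1)"] conjI allI impI)
    fix D :: "(real \<times> real) set"
    assume D: "finite D" "\<forall>(x, y)\<in>D. a \<le> x \<and> x \<le> y \<and> y \<le> b"
      "disjoint_family_on (\<lambda>(x, y). {x<..<y}) D" "(\<Sum>(x, y)\<in>D. y - x) < \<epsilon> / (C + 1)"
    have "(\<Sum>(x, y)\<in>D. norm (f y - f x)) \<le> (\<Sum>(x, y)\<in>D. (C + 1) * (y - x))"
    proof (intro sum_mono, clarify)
      fix x y assume "(x, y) \<in> D"
      then have xy: "a \<le> x" "x \<le> y" "y \<le> b" using D by auto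
      then have "norm (f y - f x) \<le> C * (y - x)"
        using lipschitz_onD[OF assms, of y x] by (simp add: dist_norm)
      also have "\<dots> \<le> (C + 1) * (y - x)" using xy by (intro mult_right_mono) auto
      finally show "norm (f y - f x) \<le> (C + 1) * (y - x)" .
    qed
    also have "\<dots> = (C + 1) * (\<Sum>(x, y)\<in>D. y - x)"
      by (simp add: sum_distrib_left case_prod_unfold)
    also have "\<dots> < \<epsilon>"
      using D(4) C by (simp add: field_simps)
    finally show "(\<Sum>(x, y)\<in>D. norm (f y - f x)) < \<epsilon>" .
  qed (use C \<open>\<epsilon> > 0\<close> in auto)
qed

lemma abs_continuous_on_interval_imp_continuous_on:
  assumes "abs_continuous_on_interval a b f"
  shows "continuous_on {a..b} f"
  unfolding continuous_on_iff
proof (intro ballI allI impI)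
  fix x \<epsilon> :: real assume x: "x \<in> {a..b}" and "\<epsilon> > 0"
  obtain \<eta> where \<eta>: "\<eta> > 0"
    "\<And>D. \<lbrakk>finite D; \<And>x y. (x, y) \<in> D \<Longrightarrow> a \<le> x \<and> x \<le> y \<and> y \<le> b;
        disjoint_family_on (\<lambda>(x, y). {x<..<y}) D; (\<Sum>(x, y)\<in>D. y - x) < \<eta>\<rbrakk>
        \<Longrightarrow> (\<Sum>(x, y)\<in>D. norm (f y - f x)) < \<epsilon>"
    using abs_continuous_on_intervalD[OF assms \<open>\<epsilon> > 0\<close>] by blast
  show "\<exists>d>0. \<forall>y\<in>{a..b}. dist y x < d \<longrightarrow> dist (f y) (f x) < \<epsilon>"
  proof (intro exI[of _ \<eta>] conjI \<eta>(1) ballI impI)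
    fix y assume y: "y \<in> {a..b}" "dist y x < \<eta>"
    have "(\<Sum>(x, y)\<in>{(min x y, max x y)}. norm (f y - f x)) < \<epsilon>"
      by (rule \<eta>(2)) (use x y in \<open>auto simp: disjoint_family_on_def dist_norm\<close>)
    then show "dist (f y) (f x) < \<epsilon>"
      by (auto simp: dist_norm min_def max_def norm_minus_commute split: if_splits)
  qed
qed

text \<open>Cousin's lemma: the intervals of a fine tagged division whose tag is exceptional have
  small total length, so absolute continuity controls their contribution; on the others the
  derivative does.\<close>

lemma abs_continuous_on_interval_derivative_bound:
  fixes f :: "real \<Rightarrow> 'a::real_normed_vector"
  assumes ac: "abs_continuous_on_interval a b f" and "a \<le> b" and "M \<ge> 0"
    and ae: "AE r in lebesgue. r \<in> {a..b} \<longrightarrow>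
        (\<exists>v. (f has_vector_derivative v) (at r) \<and> norm v \<le> M)"
  shows "norm (f b - f a) \<le> M * (b - a)"
proof -
  define N where "N = {r \<in> {a..b}. \<not> (\<exists>v. (f has_vector_derivative v) (at r) \<and> norm v \<le> M)}"
  obtain N' where N': "N \<subseteq> N'" "N' \<in> null_sets lebesgue"
    using ae by (rule AE_E) (auto simp: N_def null_sets_def)
  have main: "norm (f b - f a) \<le> (M + \<epsilon>) * (b - a) + \<epsilon>" if "\<epsilon> > 0" for \<epsilon>
  proof -
    obtain \<eta> where \<eta>: "\<eta> > 0"
      "\<And>D. \<lbrakk>finite D; \<And>x y. (x, y) \<in> D \<Longrightarrow> a \<le> x \<and> x \<le> y \<and> y \<le> b;
          disjoint_family_on (\<lambda>(x, y). {x<..<y}) D; (\<Sum>(x, y)\<in>D. y - x) < \<eta>\<rbrakk>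
          \<Longrightarrow> (\<Sum>(x, y)\<in>D. norm (f y - f x)) < \<epsilon>"
      using abs_continuous_on_intervalD[OF ac \<open>\<epsilon> > 0\<close>] by blast
    \<comment> \<open>Every division interval with an exceptional tag will be forced into
      \<open>U\<close>. These intervals are disjoint up to endpoints, so their total length stays
      below \<open>\<eta>\<close>.\<close>
    obtain U where U: "open U" "N' \<subseteq> U" "emeasure lebesgue U < ennreal \<eta>"
    proof -
      obtain U where U: "open U" "N' \<subseteq> U" "(U - N') \<in> lmeasurable"
          "emeasure lebesgue (U - N') < ennreal \<eta>"
        using sets_lebesgue_outer_open[of N' \<eta>] N' \<eta>(1) by blast
      have "emeasure lebesgue (U - N') = emeasure lebesgue U"
        by (rule emeasure_Diff_null_set[OF N'(2)]) (use U(1) in auto)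
      then show thesis using U that by auto
    qed
    \<comment> \<open>Straddle estimate: the tag lies between the endpoints, so the two first-order
      errors \<open>\<epsilon> * (z - x)\<close> and \<open>\<epsilon> * (x - y)\<close> add up to
      \<open>\<epsilon> * (z - y)\<close>.\<close>
    have "\<exists>d>0. \<forall>y z. \<bar>y - x\<bar> < d \<and> \<bar>z - x\<bar> < d \<and> y \<le> x \<and> x \<le> z \<longrightarrow>
            norm (f z - f y) \<le> (M + \<epsilon>) * (z - y)" if x: "x \<in> {a..b} - N" for x
    proof -
      obtain v where v: "(f has_vector_derivative v) (at x)" "norm v \<le> M"
        using x by (auto simp: N_def)
      then obtain d where d: "d > 0"
        "\<And>y. norm (y - x) < d \<Longrightarrow> norm (f y - f x - (y - x) *\<^sub>R v) \<le> \<epsilon> * norm (y - x)"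
        using \<open>\<epsilon> > 0\<close> unfolding has_vector_derivative_def has_derivative_at_alt by blast
      show ?thesis
      proof (intro exI[of _ d] conjI d(1) allI impI)
        fix y z assume yz: "\<bar>y - x\<bar> < d \<and> \<bar>z - x\<bar> < d \<and> y \<le> x \<and> x \<le> z"
        have "f z - f y = (f z - f x - (z - x) *\<^sub>R v) - (f y - f x - (y - x) *\<^sub>R v) + (z - y) *\<^sub>R v"
          by (simp add: algebra_simps)
        also have "norm \<dots> \<le> \<epsilon> * norm (z - x) + \<epsilon> * norm (y - x) + norm ((z - y) *\<^sub>R v)"
          by (intro order_trans[OF norm_triangle_ineq] add_mono
              order_trans[OF norm_triangle_ineq4] d(2)) (use yz in auto)
        also have "\<dots> \<le> \<epsilon> * (z - x) + \<epsilon> * (x - y) + (z - y) * M"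
          using yz v(2) by (auto intro: mult_left_mono)
        also have "\<dots> = (M + \<epsilon>) * (z - y)" by (simp add: algebra_simps)
        finally show "norm (f z - f y) \<le> (M + \<epsilon>) * (z - y)" .
      qed
    qed
    then obtain d where d: "\<And>x. x \<in> {a..b} - N \<Longrightarrow> d x > 0"
      "\<And>x y z. \<lbrakk>x \<in> {a..b} - N; \<bar>y - x\<bar> < d x; \<bar>z - x\<bar> < d x; y \<le> x; x \<le> z\<rbrakk> \<Longrightarrow>
            norm (f z - f y) \<le> (M + \<epsilon>) * (z - y)"
      by metis
    \<comment> \<open>Outside \<open>{a..b}\<close> no tag occurs, and the unit ball merely makes
      \<open>g\<close> a gauge.\<close>
    define g where "g x = (if x \<in> N then U else if x \<in> {a..b} then ball x (d x) else ball x 1)" for x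
    have "gauge g"
      unfolding gauge_def g_def using U N'(1) d(1) by auto
    then obtain p where p: "p tagged_division_of {a..b}" "g fine p"
      using fine_division_exists_real by blast
    note pD = tagged_division_ofD[OF p(1)]
    have K: "\<exists>y z. K = {y..z} \<and> Inf K = y \<and> Sup K = z \<and> a \<le> y \<and> y \<le> x \<and> x \<le> z \<and> z \<le> b \<and>
              x \<in> {a..b} \<and> {y..z} \<subseteq> g x"
      if xK: "(x, K) \<in> p" for x K
    proof -
      obtain y z where yz: "K = {y..z}" using pD(4)[OF xK] by auto
      with pD(2,3)[OF xK] p(2) xK show ?thesis
        by (auto simp: fine_def)
    qed
    define p1 where "p1 = {(x, K) \<in> p. x \<in> N}"
    define p2 where "p2 = {(x, K) \<in> p. x \<notin> N}"
    have split: "p = p1 \<union> p2" "p1 \<inter> p2 = {}" and fin: "finite p1" "finite p2"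
      using pD(1) by (auto simp: p1_def p2_def intro: finite_subset[of _ p])
    have "norm (f b - f a) = norm (\<Sum>(x, K)\<in>p. f (Sup K) - f (Inf K))"
      by (simp only: additive_tagged_division_1[OF \<open>a \<le> b\<close> p(1)])
    also have "\<dots> \<le> (\<Sum>(x, K)\<in>p. norm (f (Sup K) - f (Inf K)))"
      by (intro order_trans[OF norm_sum] sum_mono) auto
    also have "\<dots> = (\<Sum>(x, K)\<in>p2. norm (f (Sup K) - f (Inf K)))
        + (\<Sum>(x, K)\<in>p1. norm (f (Sup K) - f (Inf K)))"
      unfolding split(1) using fin split(2) by (subst sum.union_disjoint) auto
    also have "\<dots> \<le> (M + \<epsilon>) * (b - a) + \<epsilon>"
    proof (rule add_mono)
      have "(\<Sum>(x, K)\<in>p2. norm (f (Sup K) - f (Inf K))) \<le> (\<Sum>(x, K)\<in>p2. (M + \<epsilon>) * measure lborel K)"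
      proof (intro sum_mono, clarify)
        fix x K assume xK: "(x, K) \<in> p2"
        then obtain y z where yz: "K = {y..z}" "Inf K = y" "Sup K = z" "y \<le> x" "x \<le> z"
            "x \<in> {a..b}" "{y..z} \<subseteq> g x"
          using K[of x K] by (auto simp: p2_def)
        have "x \<notin> N" using xK by (auto simp: p2_def)
        then have "{y..z} \<subseteq> ball x (d x)" using yz by (auto simp: g_def)
        then have "y \<in> ball x (d x)" "z \<in> ball x (d x)"
          using yz by (auto simp del: mem_ball)
        then have "norm (f z - f y) \<le> (M + \<epsilon>) * (z - y)"
          using yz \<open>x \<notin> N\<close> by (intro d(2)[of x]) (auto simp: dist_real_def)
        then show "norm (f (Sup K) - f (Inf K)) \<le> (M + \<epsilon>) * measure lborel K"
          using yz by simp
      qed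
      also have "\<dots> \<le> (\<Sum>(x, K)\<in>p. (M + \<epsilon>) * measure lborel K)"
        by (rule sum_mono2) (use pD(1) split \<open>M \<ge> 0\<close> \<open>\<epsilon> > 0\<close> in auto)
      also have "\<dots> = (M + \<epsilon>) * (\<Sum>(x, K)\<in>p. measure lborel K)"
        by (simp add: sum_distrib_left case_prod_unfold)
      also have "(\<Sum>(x, K)\<in>p. measure lborel K) = b - a"
        using additive_content_tagged_division[of p a b] p(1) \<open>a \<le> b\<close> by simp
      finally show "(\<Sum>(x, K)\<in>p2. norm (f (Sup K) - f (Inf K))) \<le> (M + \<epsilon>) * (b - a)" .
    next
      \<comment> \<open>Absolute continuity speaks about sets of endpoint pairs, so tags have to be
        forgotten; the sums carry over because \<open>e\<close> is injective on
        \<open>p1\<close>.\<close>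
      define e where "e = (\<lambda>(x::real, K::real set). (Inf K, Sup K))"
      have disj: "{Inf K<..<Sup K} \<inter> {Inf K'<..<Sup K'} = {}"
        if in_p: "(x, K) \<in> p" "(x', K') \<in> p" and ne: "(x, K) \<noteq> (x', K')" for x K x' K'
      proof -
        obtain y z where "K = {y..z}" "Inf K = y" "Sup K = z" using K[OF in_p(1)] by blast
        moreover obtain y' z' where "K' = {y'..z'}" "Inf K' = y'" "Sup K' = z'"
          using K[OF in_p(2)] by blast
        ultimately show ?thesis using pD(5)[OF in_p ne] by simp
      qed
      have inj: "inj_on e p1"
      proof (rule inj_onI, clarify)
        fix x K x' K' assume *: "(x, K) \<in> p1" "(x', K') \<in> p1" "e (x, K) = e (x', K')"
        then have in_p: "(x, K) \<in> p" "(x', K') \<in> p" by (auto simp: p1_def)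
        obtain y z where yz: "K = {y..z}" "Inf K = y" "Sup K = z" "y \<le> x" "x \<le> z"
          using K[OF in_p(1)] by blast
        obtain y' z' where yz': "K' = {y'..z'}" "Inf K' = y'" "Sup K' = z'" "y' \<le> x'" "x' \<le> z'"
          using K[OF in_p(2)] by blast
        \<comment> \<open>Distinct members of the division have disjoint interiors. Equal endpoints
          therefore leave a single point, and the tags, lying in that interval, coincide as
          well.\<close>
        have eq: "y = y'" "z = z'" using *(3) yz yz' by (auto simp: e_def)
        show "x = x' \<and> K = K'"
        proof (rule ccontr)
          assume "\<not> ?thesis"
          then have "{y<..<z} = {}" using disj[OF in_p] eq yz yz' by auto
          then have "y = z" using yz by auto
          then show False using yz yz' eq \<open>\<not> (x = x' \<and> K = K')\<close> by auto
        qed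
      qed
      have dfam: "disjoint_family_on (\<lambda>(x, y). {x<..<y}) (e ` p1)"
        unfolding disjoint_family_on_def
      proof (intro ballI impI)
        fix s t assume "s \<in> e ` p1" "t \<in> e ` p1" and ne: "s \<noteq> t"
        then obtain u K u' K' where *: "(u, K) \<in> p1" "(u', K') \<in> p1"
            "s = e (u, K)" "t = e (u', K')" by auto
        then have in_p: "(u, K) \<in> p" "(u', K') \<in> p" by (auto simp: p1_def)
        have "(u, K) \<noteq> (u', K')" using * ne by auto
        then show "(case s of (x, y) \<Rightarrow> {x<..<y}) \<inter> (case t of (x, y) \<Rightarrow> {x<..<y}) = {}"
          using disj[OF in_p] * by (simp add: e_def)
      qed
      have rng: "a \<le> x \<and> x \<le> y \<and> y \<le> b \<and> {x..y} \<subseteq> U" if xy: "(x, y) \<in> e ` p1" for x y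
      proof -
        obtain u L where uL: "(u, L) \<in> p1" "(x, y) = e (u, L)" using xy by auto
        then have "(u, L) \<in> p" "u \<in> N" by (auto simp: p1_def)
        then show ?thesis using K[of u L] uL(2) by (auto simp: e_def g_def)
      qed
      have "ennreal (\<Sum>(x, y)\<in>e ` p1. y - x) = (\<Sum>(x, y)\<in>e ` p1. ennreal (y - x))"
        unfolding case_prod_unfold
        by (rule sum_ennreal[symmetric]) (use rng[of "fst t" "snd t" for t] in auto)
      also have "\<dots> = (\<Sum>t\<in>e ` p1. emeasure lebesgue ((\<lambda>(x, y). {x<..<y}) t))"
        using rng by (intro sum.cong) auto
      also have "\<dots> = emeasure lebesgue (\<Union>t\<in>e ` p1. (\<lambda>(x, y). {x<..<y}) t)"
        by (rule sum_emeasure) (use dfam fin in auto)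
      also have "\<dots> \<le> emeasure lebesgue U"
      proof (rule emeasure_mono)
        show "(\<Union>t\<in>e ` p1. case t of (x, y) \<Rightarrow> {x<..<y}) \<subseteq> U"
        proof (rule UN_least)
          fix t assume "t \<in> e ` p1"
          then show "(case t of (x, y) \<Rightarrow> {x<..<y}) \<subseteq> U"
            using rng[of "fst t" "snd t"] greaterThanLessThan_subseteq_atLeastAtMost_iff
            by (force simp: case_prod_unfold)
        qed
      qed (use U(1) in auto)
      also have "\<dots> < ennreal \<eta>" by (rule U(3))
      finally have small: "(\<Sum>(x, y)\<in>e ` p1. y - x) < \<eta>"
        by (meson ennreal_leI not_le)
      have "(\<Sum>(x, K)\<in>p1. norm (f (Sup K) - f (Inf K))) = (\<Sum>(x, y)\<in>e ` p1. norm (f y - f x))"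
        by (subst sum.reindex[OF inj]) (auto simp: e_def intro!: sum.cong)
      also have "\<dots> < \<epsilon>"
        by (rule \<eta>(2)) (use fin dfam small rng in auto)
      finally show "(\<Sum>(x, K)\<in>p1. norm (f (Sup K) - f (Inf K))) \<le> \<epsilon>" by simp
    qed
    finally show ?thesis .
  qed
  have "norm (f b - f a) \<le> M * (b - a) + e" if "e > 0" for e
  proof -
    \<comment> \<open>Solves \<open>c * (b - a) + c = e\<close>, the total error produced by
      \<open>main\<close>.\<close>
    define c where "c = e / (b - a + 1)"
    have c: "c > 0" "c * (b - a + 1) = e" using that \<open>a \<le> b\<close> by (auto simp: c_def)
    have "norm (f b - f a) \<le> (M + c) * (b - a) + c" using main[OF c(1)] .
    also have "\<dots> = M * (b - a) + c * (b - a + 1)" by (simp add: algebra_simps)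
    also have "\<dots> = M * (b - a) + e" by (simp only: c(2))
    finally show ?thesis .
  qed
  then show ?thesis by (rule field_le_epsilon)
qed


section \<open>Differentiation of indefinite integrals\<close>

text \<open>\<open>integrable_ccontinuous_explicit\<close> controls right-hand difference quotients;
  applied to the reflected integrand \<open>\<lambda>x. f (- x)\<close> it controls the left-hand
  ones. The quotients at \<open>x\<close> involve integrals next to \<open>x\<close> alone, so one
  null set serves all base points \<open>a < x\<close>.\<close>

lemma indefinite_integral_has_vector_derivative_AE:
  fixes f :: "real \<Rightarrow> 'a::euclidean_space"
  assumes int: "\<And>a b. f integrable_on {a..b}"
  shows "AE x in lebesgue. \<forall>a<x. ((\<lambda>t. integral {a..t} f) has_vector_derivative f x) (at x)"
proof -
  obtain N where N: "negligible N"
    "\<And>x e. \<lbrakk>x \<notin> N; 0 < e\<rbrakk> \<Longrightarrow>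
       \<exists>d>0. \<forall>h. 0 < h \<and> h < d \<longrightarrow> norm (integral {x..x + h} f /\<^sub>R h - f x) < e"
    using integrable_ccontinuous_explicit[of f] int by auto
  have "(\<lambda>x. f (- x)) integrable_on {a..b}" for a b
    using Henstock_Kurzweil_Integration.integrable_reflect_real[of f "- a" "- b"] int by simp
  then obtain N' where N': "negligible N'"
    "\<And>x e. \<lbrakk>x \<notin> N'; 0 < e\<rbrakk> \<Longrightarrow>
       \<exists>d>0. \<forall>h. 0 < h \<and> h < d \<longrightarrow>
         norm (integral {x..x + h} (\<lambda>x. f (- x)) /\<^sub>R h - f (- x)) < e"
    using integrable_ccontinuous_explicit[of "\<lambda>x. f (- x)"] by auto
  have neg: "negligible (N \<union> uminus ` N')"
    using N(1) N'(1)
    by (intro negligible_Un negligible_differentiable_image_negligible) (auto intro!: derivative_intros simp: differentiable_on_def)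
  have "((\<lambda>t. integral {a..t} f) has_vector_derivative f x) (at x)"
    if x: "x \<notin> N \<union> uminus ` N'" and "a < x" for x a
    unfolding has_vector_derivative_def has_derivative_at_alt
  proof (intro conjI allI impI)
    show "bounded_linear (\<lambda>h. h *\<^sub>R f x)" by (rule bounded_linear_scaleR_left)
    fix e :: real assume "e > 0"
    have xN: "x \<notin> N" "- x \<notin> N'" using x by force+
    obtain d where d: "d > 0" "\<And>h. \<lbrakk>0 < h; h < d\<rbrakk> \<Longrightarrow> norm (integral {x..x + h} f /\<^sub>R h - f x) < e"
      using N(2)[OF xN(1) \<open>e > 0\<close>] by blast
    obtain d' where d': "d' > 0" "\<And>h. \<lbrakk>0 < h; h < d'\<rbrakk> \<Longrightarrow>
        norm (integral {- x..- x + h} (\<lambda>x. f (- x)) /\<^sub>R h - f x) < e"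
      using N'(2)[OF xN(2) \<open>e > 0\<close>] by auto
    have scale: "norm (I - h *\<^sub>R f x) \<le> e * h" if "norm (I /\<^sub>R h - f x) < e" "h > 0" for I h
    proof -
      have "I - h *\<^sub>R f x = h *\<^sub>R (I /\<^sub>R h - f x)"
        using that by (simp add: scaleR_diff_right)
      then have "norm (I - h *\<^sub>R f x) = h * norm (I /\<^sub>R h - f x)" using that by simp
      then show ?thesis using that by (simp add: mult.commute)
    qed
    show "\<exists>d>0. \<forall>y. norm (y - x) < d \<longrightarrow>
        norm (integral {a..y} f - integral {a..x} f - (y - x) *\<^sub>R f x) \<le> e * norm (y - x)"
    \<comment> \<open>The third bound keeps \<open>y\<close> to the right of \<open>a\<close>, where
      the integrals can be split.\<close>
    proof (intro exI[of _ "min (min d d') (x - a)"] conjI allI impI)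
      fix y assume y: "norm (y - x) < min (min d d') (x - a)"
      consider "y = x" | "y > x" | "y < x" by linarith
      then show "norm (integral {a..y} f - integral {a..x} f - (y - x) *\<^sub>R f x) \<le> e * norm (y - x)"
      proof cases
        case 2
        have "integral {a..y} f - integral {a..x} f = integral {x..y} f"
          using Henstock_Kurzweil_Integration.integral_combine[of a x y f] 2 \<open>a < x\<close> int
          by (simp add: algebra_simps)
        moreover have "norm (integral {x..x + (y - x)} f - (y - x) *\<^sub>R f x) \<le> e * (y - x)"
          using 2 y by (intro scale d) auto
        ultimately show ?thesis using 2 by simp
      next
        case 3
        have "integral {a..y} f - integral {a..x} f = - integral {y..x} f"
          using Henstock_Kurzweil_Integration.integral_combine[of a y x f] 3 y int
          by (simp add: algebra_simps)
        then have "integral {a..y} f - integral {a..x} f - (y - x) *\<^sub>R f x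
            = - (integral {y..x} f - (x - y) *\<^sub>R f x)"
          by (simp add: algebra_simps)
        moreover have "norm (integral {- x..- x + (x - y)} (\<lambda>x. f (- x)) - (x - y) *\<^sub>R f x) \<le> e * (x - y)"
          using 3 y by (intro scale d') auto
        moreover have "integral {- x..- x + (x - y)} (\<lambda>x. f (- x)) = integral {y..x} f"
          using Henstock_Kurzweil_Integration.integral_reflect_real[of x y f] by simp
        ultimately show ?thesis
          using 3 by (simp only: norm_minus_cancel) simp
      qed simp
    qed (use d d' \<open>a < x\<close> in auto)
  qed
  then show ?thesis
    using neg by (intro AE_I'[of "N \<union> uminus ` N'"]) (auto simp: negligible_iff_null_sets)
qed


section \<open>Linear Caratheodory equations\<close>

lemma borel_measurable_vec_lambdaI:
  fixes f :: "'a \<Rightarrow> real ^ 'n"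
  assumes "\<And>i. (\<lambda>x. f x $ i) \<in> borel_measurable M"
  shows "f \<in> borel_measurable M"
  using assms by (subst borel_measurable_euclidean_space) (auto simp: Basis_vec_def inner_axis)

lemma integrable_on_vec_nth:
  fixes f :: "'a::euclidean_space \<Rightarrow> real ^ 'n"
  shows "f integrable_on S \<Longrightarrow> (\<lambda>x. f x $ i) integrable_on S"
  using integrable_linear[OF _ bounded_linear_vec_nth] by (force simp: o_def)

lemma continuous_on_integral_upper:
  fixes f :: "real \<Rightarrow> 'a::euclidean_space"
  assumes "\<And>b. f integrable_on {s..b}"
  shows "continuous_on UNIV (\<lambda>t. integral {s..t} f)"
proof -
  have "isCont (\<lambda>t. integral {s..t} f) t" for t
  proof -
    \<comment> \<open>\<open>max s x\<close> keeps the upper limit inside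
      \<open>{s..max s (t + 1)}\<close>, where continuity is known. Left of \<open>s\<close> both
      integrals vanish, one over a point and one over the empty set.\<close>
    have "continuous_on {..<t + 1} (\<lambda>x. integral {s..max s x} f)"
      by (rule continuous_on_compose2[OF indefinite_integral_continuous_1[OF assms[of "max s (t + 1)"]]])
        (auto intro!: continuous_intros)
    then have "continuous_on {..<t + 1} (\<lambda>x. integral {s..x} f)"
      by (rule continuous_on_eq) (auto simp: max_def)
    then show ?thesis
      by (simp add: continuous_on_eq_continuous_at)
  qed
  then show ?thesis by (simp add: continuous_on_eq_continuous_at)
qed

section \<open>Picard iteration for a nonnegative matrix with constant column sums\<close>

primrec picard :: "(real \<Rightarrow> real ^ 'n ^ 'n) \<Rightarrow> real \<Rightarrow> real ^ 'n \<Rightarrow> nat \<Rightarrow> real \<Rightarrow> real ^ 'n" where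
  "picard B s v 0 = (\<lambda>t. v)"
| "picard B s v (Suc n) = (\<lambda>t. v + integral {s..t} (\<lambda>r. B r *v picard B s v n r))"

text \<open>\<open>B\<close> stands for the shifted coefficient
  \<open>(transpose Q + q I) / \<delta>\<close> along a path, and \<open>c\<close> for
  \<open>q / \<delta>\<close>.\<close>

context
  fixes B :: "real \<Rightarrow> real ^ 'n ^ 'n" and c :: real
  assumes B_measurable: "\<And>i j. (\<lambda>r. B r $ i $ j) \<in> borel_measurable lebesgue"
    and B_nonneg: "\<And>r i j. 0 \<le> B r $ i $ j"
    and B_column_sum: "\<And>r j. (\<Sum>i\<in>UNIV. B r $ i $ j) = c"
begin

lemma rate_nonneg: "c \<ge> 0"
  using B_column_sum[of undefined undefined] B_nonneg by (metis sum_nonneg)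

text \<open>Equal column sums decouple the total mass: it obeys the scalar equation m' = c m, the
  source of all exponential bounds below.\<close>

lemma sum_mult_eq: "(\<Sum>i\<in>UNIV. (B r *v x) $ i) = c * (\<Sum>j\<in>UNIV. x $ j)"
proof -
  have "(\<Sum>i\<in>UNIV. (B r *v x) $ i) = (\<Sum>i\<in>UNIV. \<Sum>j\<in>UNIV. B r $ i $ j * x $ j)"
    by (simp add: matrix_vector_mult_def)
  also have "\<dots> = (\<Sum>j\<in>UNIV. \<Sum>i\<in>UNIV. B r $ i $ j * x $ j)"
    by (rule sum.swap)
  also have "\<dots> = c * (\<Sum>j\<in>UNIV. x $ j)"
    by (simp add: sum_distrib_right[symmetric] B_column_sum sum_distrib_left[symmetric])
  finally show ?thesis .
qed

lemma mult_nonneg_vec: "(\<And>j. 0 \<le> x $ j) \<Longrightarrow> 0 \<le> (B r *v x) $ i"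
  by (simp add: matrix_vector_mult_def sum_nonneg B_nonneg)

lemma norm_mult_le:
  assumes "\<And>j. 0 \<le> x $ j" "(\<Sum>j\<in>UNIV. x $ j) \<le> H"
  shows "norm (B r *v x) \<le> c * H"
proof -
  have "norm (B r *v x) \<le> (\<Sum>i\<in>UNIV. \<bar>(B r *v x) $ i\<bar>)" by (rule norm_le_l1_cart)
  also have "\<dots> = c * (\<Sum>j\<in>UNIV. x $ j)"
    using assms(1) by (simp add: mult_nonneg_vec sum_mult_eq)
  also have "\<dots> \<le> c * H" using assms(2) rate_nonneg by (rule mult_left_mono)
  finally show ?thesis .
qed

lemma mult_integrable:
  assumes y: "y \<in> borel_measurable lebesgue"
    and "\<And>r j. r \<in> {a..b} \<Longrightarrow> 0 \<le> y r $ j"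
    and "\<And>r. r \<in> {a..b} \<Longrightarrow> (\<Sum>j\<in>UNIV. y r $ j) \<le> H"
  shows "(\<lambda>r. B r *v y r) integrable_on {a..b}"
proof (rule measurable_bounded_by_integrable_imp_integrable)
  have yj: "(\<lambda>r. y r $ j) \<in> borel_measurable lebesgue" for j
    using y by (rule borel_measurable_continuous_on[rotated]) (auto intro!: continuous_intros)
  have "(\<lambda>r. B r *v y r) \<in> borel_measurable lebesgue"
    by (rule borel_measurable_vec_lambdaI)
      (auto simp: matrix_vector_mult_def intro!: borel_measurable_sum borel_measurable_times B_measurable yj)
  then show "(\<lambda>r. B r *v y r) \<in> borel_measurable (lebesgue_on {a..b})"
    by (rule measurable_restrict_space1)
  show "(\<lambda>r. c * H) integrable_on {a..b}" by (rule integrable_const_ivl)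
  show "norm (B r *v y r) \<le> c * H" if "r \<in> {a..b}" for r
    using assms(2,3)[OF that] by (intro norm_mult_le) auto
qed simp

context
  fixes s :: real and v :: "real ^ 'n"
  assumes v_nonneg: "\<And>i. 0 \<le> v $ i"
begin

text \<open>Gives a constant bound on any interval, wherever \<open>s\<close> lies relative to it,
  and so a constant dominating function for the integrals.\<close>

lemma exponential_bound_mono:
  assumes "r \<in> {a..b}"
  shows "(\<Sum>i\<in>UNIV. v $ i) * exp (c * \<bar>r - s\<bar>) \<le> (\<Sum>i\<in>UNIV. v $ i) * exp (c * (\<bar>a - s\<bar> + \<bar>b - s\<bar>))"
proof -
  have "\<bar>r - s\<bar> \<le> \<bar>a - s\<bar> + \<bar>b - s\<bar>" using assms by auto
  then show ?thesis
    using v_nonneg rate_nonneg by (intro mult_left_mono) (auto intro: mult_left_mono sum_nonneg)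
qed

text \<open>The three properties are proved together because the next integrand is integrable only
  thanks to measurability, nonnegativity and boundedness of the current iterate. The mass bound is
  inductive since \<open>\<lambda>t. V * exp (c * (t - s))\<close>, with \<open>V\<close> the mass
  of \<open>v\<close>, is a fixed point of the integrated mass equation. For \<open>t < s\<close>
  the integral is over an empty interval, the iterate equals \<open>v\<close>, and the absolute
  value keeps the bound true.\<close>

lemma picard_bounds:
  "picard B s v n \<in> borel_measurable lebesgue \<and> (\<forall>t i. v $ i \<le> picard B s v n t $ i) \<and>
   (\<forall>t. (\<Sum>i\<in>UNIV. picard B s v n t $ i) \<le> (\<Sum>i\<in>UNIV. v $ i) * exp (c * \<bar>t - s\<bar>))"
proof (induction n)
  case 0
  have "(\<Sum>i\<in>UNIV. v $ i) * 1 \<le> (\<Sum>i\<in>UNIV. v $ i) * exp (c * \<bar>t - s\<bar>)" for t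
    using v_nonneg rate_nonneg by (intro mult_left_mono) (auto intro: sum_nonneg)
  then show ?case by simp
next
  case (Suc n)
  let ?y = "picard B s v n" and ?f = "\<lambda>r. B r *v picard B s v n r"
  have nonneg: "0 \<le> ?y t $ i" for t i using Suc v_nonneg by (meson order_trans)
  have int: "?f integrable_on {a..b}" for a b
    using Suc nonneg exponential_bound_mono[of _ a b]
    by (intro mult_integrable[where H = "(\<Sum>i\<in>UNIV. v $ i) * exp (c * (\<bar>a - s\<bar> + \<bar>b - s\<bar>))"])
      (auto intro: order_trans)
  have "continuous_on UNIV (picard B s v (Suc n))"
    unfolding picard.simps by (intro continuous_intros continuous_on_integral_upper int)
  then have meas: "picard B s v (Suc n) \<in> borel_measurable lebesgue"
    using borel_measurable_continuous_onI measurable_completion by (metis measurable_lborel2)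
  have comp: "integral {s..t} ?f $ i = integral {s..t} (\<lambda>r. ?f r $ i)" for t i
    using int by simp
  have low: "v $ i \<le> picard B s v (Suc n) t $ i" for t i
    using Henstock_Kurzweil_Integration.integral_nonneg[of "\<lambda>r. ?f r $ i" "{s..t}"]
      integrable_on_vec_nth[OF int] nonneg
    by (auto simp: comp mult_nonneg_vec)
  have up: "(\<Sum>i\<in>UNIV. picard B s v (Suc n) t $ i) \<le> (\<Sum>i\<in>UNIV. v $ i) * exp (c * \<bar>t - s\<bar>)" for t
  proof (cases "s \<le> t")
    case True
    let ?V = "\<Sum>i\<in>UNIV. v $ i"
    have bl: "bounded_linear (\<lambda>x :: real ^ 'n. \<Sum>i\<in>UNIV. x $ i)"
      by (intro bounded_linear_sum bounded_linear_vec_nth)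
    have "((\<lambda>r. c * ?V * exp (c * (r - s))) has_integral ?V * exp (c * (t - s)) - ?V * exp (c * (s - s))) {s..t}"
      by (rule fundamental_theorem_of_calculus[OF True])
        (auto intro!: derivative_eq_intros simp: has_real_derivative_iff_has_vector_derivative[symmetric])
    then have I: "((\<lambda>r. c * ?V * exp (c * (r - s))) has_integral ?V * exp (c * (t - s)) - ?V) {s..t}"
      by simp
    have "(\<Sum>i\<in>UNIV. picard B s v (Suc n) t $ i) = ?V + (\<Sum>i\<in>UNIV. integral {s..t} ?f $ i)"
      by (simp add: sum.distrib)
    also have "(\<Sum>i\<in>UNIV. integral {s..t} ?f $ i) = integral {s..t} (\<lambda>r. \<Sum>i\<in>UNIV. ?f r $ i)"
      using integral_linear[OF int bl] by (simp add: o_def)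
    also have "\<dots> \<le> integral {s..t} (\<lambda>r. c * ?V * exp (c * (r - s)))"
    proof (rule integral_le)
      show "(\<lambda>r. \<Sum>i\<in>UNIV. ?f r $ i) integrable_on {s..t}"
        using integrable_linear[OF int bl] by (simp add: o_def)
      fix r assume r: "r \<in> {s..t}"
      have "(\<Sum>i\<in>UNIV. ?f r $ i) = c * (\<Sum>j\<in>UNIV. ?y r $ j)" by (rule sum_mult_eq)
      also have "\<dots> \<le> c * (?V * exp (c * \<bar>r - s\<bar>))"
        using Suc rate_nonneg by (intro mult_left_mono) auto
      finally show "(\<Sum>i\<in>UNIV. ?f r $ i) \<le> c * ?V * exp (c * (r - s))"
        using r by (simp add: mult.assoc)
    qed (rule has_integral_integrable[OF I])
    also have "\<dots> = ?V * exp (c * (t - s)) - ?V" by (rule integral_unique[OF I])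
    finally show ?thesis using True by simp
  next
    case False
    have "(\<Sum>i\<in>UNIV. v $ i) * 1 \<le> (\<Sum>i\<in>UNIV. v $ i) * exp (c * \<bar>t - s\<bar>)"
      using v_nonneg rate_nonneg by (intro mult_left_mono) (auto intro: sum_nonneg)
    then show ?thesis using False by simp
  qed
  show ?case using meas low up by blast
qed

lemma picard_nonneg: "0 \<le> picard B s v n t $ i"
  using picard_bounds v_nonneg by (meson order_trans)

lemma picard_integrable: "(\<lambda>r. B r *v picard B s v n r) integrable_on {a..b}"
  using picard_bounds[of n] picard_nonneg[of n]
  by (intro mult_integrable[where H = "(\<Sum>i\<in>UNIV. v $ i) * exp (c * (\<bar>a - s\<bar> + \<bar>b - s\<bar>))"])
    (blast intro: order_trans exponential_bound_mono)+

text \<open>A nonnegative \<open>B\<close> makes the integral operator order preserving, and the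
  first iterate already lies above \<open>v\<close>.\<close>

lemma picard_mono: "picard B s v n t $ i \<le> picard B s v (Suc n) t $ i"
proof (induction n arbitrary: t i)
  case 0
  then show ?case using picard_bounds[of "Suc 0"] by simp
next
  case (Suc n)
  have "integral {s..t} (\<lambda>r. (B r *v picard B s v n r) $ i)
      \<le> integral {s..t} (\<lambda>r. (B r *v picard B s v (Suc n) r) $ i)"
    using Suc
    by (intro integral_le integrable_on_vec_nth picard_integrable)
      (auto simp: matrix_vector_mult_def B_nonneg intro!: sum_mono mult_left_mono
        simp del: picard.simps)
  then have "integral {s..t} (\<lambda>r. B r *v picard B s v n r) $ i
      \<le> integral {s..t} (\<lambda>r. B r *v picard B s v (Suc n) r) $ i"
    using picard_integrable by (simp del: picard.simps)
  then show ?case by (simp add: picard.simps(2)[of B s v "Suc n"] picard.simps(2)[of B s v n] del: picard.simps)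
qed

text \<open>The iterates increase and each entry is at most the bounded total mass, so pointwise
  limits exist. Dominated convergence with a constant majorant passes the limit through the
  integral; no uniform convergence is involved.\<close>

lemma picard_limit:
  obtains y :: "real \<Rightarrow> real ^ 'n" where
    "\<And>a b. (\<lambda>r. B r *v y r) integrable_on {a..b}"
    "\<And>t. y t = v + integral {s..t} (\<lambda>r. B r *v y r)"
    "\<And>t i. v $ i \<le> y t $ i"
    "\<And>t. (\<Sum>i\<in>UNIV. y t $ i) \<le> (\<Sum>i\<in>UNIV. v $ i) * exp (c * \<bar>t - s\<bar>)"
proof -
  have "\<exists>l. (\<lambda>n. picard B s v n t $ i) \<longlonglongrightarrow> l" for t i
  proof (rule incseq_convergent)
    show "incseq (\<lambda>n. picard B s v n t $ i)" using picard_mono by (rule incseq_SucI)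
    show "\<forall>n. picard B s v n t $ i \<le> (\<Sum>i\<in>UNIV. v $ i) * exp (c * \<bar>t - s\<bar>)"
    proof
      fix n
      have "picard B s v n t $ i \<le> (\<Sum>i\<in>UNIV. picard B s v n t $ i)"
        using picard_nonneg by (intro member_le_sum) auto
      then show "picard B s v n t $ i \<le> (\<Sum>i\<in>UNIV. v $ i) * exp (c * \<bar>t - s\<bar>)"
        using picard_bounds[of n] by (meson order_trans)
    qed
  qed blast
  then obtain l where l: "\<And>t i. (\<lambda>n. picard B s v n t $ i) \<longlonglongrightarrow> l t i" by metis
  define y where "y t = (\<chi> i. l t i)" for t
  have lim: "(\<lambda>n. picard B s v n t) \<longlonglongrightarrow> y t" for t
    by (rule vec_tendstoI) (simp add: y_def l)
  have limB: "(\<lambda>n. B r *v picard B s v n r) \<longlonglongrightarrow> B r *v y r" for r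
    by (rule vec_tendstoI) (auto simp: matrix_vector_mult_def intro!: tendsto_intros lim)
  have dom: "norm (B r *v picard B s v n r) \<le> c * ((\<Sum>i\<in>UNIV. v $ i) * exp (c * (\<bar>a - s\<bar> + \<bar>b - s\<bar>)))"
    if "r \<in> {a..b}" for n r a b
    using picard_nonneg picard_bounds[of n] exponential_bound_mono[OF that]
    by (intro norm_mult_le) (auto intro: order_trans)
  have int: "(\<lambda>r. B r *v y r) integrable_on {a..b}" for a b
    by (rule dominated_convergence(1)[OF picard_integrable integrable_const_ivl dom limB])
  have eq: "y t = v + integral {s..t} (\<lambda>r. B r *v y r)" for t
  proof (rule LIMSEQ_unique)
    show "(\<lambda>n. picard B s v (Suc n) t) \<longlonglongrightarrow> y t"
      using lim by (rule LIMSEQ_Suc)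
    show "(\<lambda>n. picard B s v (Suc n) t) \<longlonglongrightarrow> v + integral {s..t} (\<lambda>r. B r *v y r)"
      unfolding picard.simps
      by (intro tendsto_intros dominated_convergence(2)[OF picard_integrable integrable_const_ivl dom limB])
  qed
  have low: "v $ i \<le> y t $ i" for t i
    using picard_bounds by (intro LIMSEQ_le_const[OF tendsto_vec_nth[OF lim]]) auto
  have up: "(\<Sum>i\<in>UNIV. y t $ i) \<le> (\<Sum>i\<in>UNIV. v $ i) * exp (c * \<bar>t - s\<bar>)" for t
    using picard_bounds by (intro LIMSEQ_le_const2[OF tendsto_sum[OF tendsto_vec_nth[OF lim]]]) auto
  show thesis by (rule that[OF int eq low up])
qed

text \<open>The last conjunct keeps two contributions to entry \<open>k\<close>: its initial value,
  and the inflow from \<open>j\<close>, where \<open>y\<close> never falls below \<open>v\<close>.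
  All other inflow is nonnegative and dropped. With \<open>b = 0\<close> it yields nonnegativity of
  the solution, with a positive lower bound on a rate it yields the minorization.\<close>

lemma caratheodory_solution_nonneg_exists:
  assumes "s \<le> t" "\<delta> > 0"
    and B: "\<And>r x. r \<in> {s..t} \<Longrightarrow> transpose (Q (\<phi> r)) *v x = \<delta> *\<^sub>R (B r *v x - c *\<^sub>R x)"
  shows "\<exists>p. caratheodory_solution Q \<delta> \<phi> s t p \<and> p s = v \<and>
    (\<forall>k j b. (\<forall>r\<in>{s..t}. b \<le> B r $ k $ j) \<longrightarrow>
        exp (- c * (t - s)) * (v $ k + b * (t - s) * v $ j) \<le> p t $ k)"
proof -
  obtain y where int: "\<And>a b. (\<lambda>r. B r *v y r) integrable_on {a..b}"
    and eq: "\<And>t. y t = v + integral {s..t} (\<lambda>r. B r *v y r)"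
    and low: "\<And>t i. v $ i \<le> y t $ i"
    and up: "\<And>t. (\<Sum>i\<in>UNIV. y t $ i) \<le> (\<Sum>i\<in>UNIV. v $ i) * exp (c * \<bar>t - s\<bar>)"
    using picard_limit by blast
  have y_nonneg: "0 \<le> y r $ i" for r i using low v_nonneg by (meson order_trans)
  \<comment> \<open>Bounds the mass of \<open>y\<close> on \<open>{s..t}\<close>, hence also its
    Euclidean norm; the shape is that of \<open>exponential_bound_mono\<close>.\<close>
  define H where "H = (\<Sum>i\<in>UNIV. v $ i) * exp (c * (\<bar>s - s\<bar> + \<bar>t - s\<bar>))"
  have H: "(\<Sum>i\<in>UNIV. y r $ i) \<le> H" if "r \<in> {s..t}" for r
    using up[of r] exponential_bound_mono[OF that] unfolding H_def by (rule order_trans)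
  have yH: "norm (y r) \<le> H" if "r \<in> {s..t}" for r
    using norm_le_l1_cart[of "y r"] H[OF that] y_nonneg by simp
  have "H \<ge> 0" using order_trans[OF norm_ge_zero yH[of s]] \<open>s \<le> t\<close> by simp
  define p where "p r = exp (- c * (r - s)) *\<^sub>R y r" for r
  have y_lip: "norm (y x' - y x) \<le> c * H * (x' - x)" if "s \<le> x" "x \<le> x'" "x' \<le> t" for x x'
  proof -
    have "y x' - y x = integral {x..x'} (\<lambda>r. B r *v y r)"
      using Henstock_Kurzweil_Integration.integral_combine[of s x x' "\<lambda>r. B r *v y r"] that int
        eq[of x] eq[of x'] by (simp add: algebra_simps)
    also have "norm \<dots> \<le> integral {x..x'} (\<lambda>r. c * H)"
      using that y_nonneg H
      by (intro integral_norm_bound_integral int integrable_const_ivl norm_mult_le) auto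
    also have "\<dots> = c * H * (x' - x)" using that by simp
    finally show ?thesis .
  qed
  have exp_lip: "\<bar>exp (- c * (x' - s)) - exp (- c * (x - s))\<bar> \<le> c * (x' - x)"
    if "s \<le> x" "x \<le> x'" for x x'
  proof -
    have "exp (- c * (x' - s)) = exp (- c * (x - s) + - c * (x' - x))"
      by (rule arg_cong[of _ _ exp]) (simp add: algebra_simps)
    then have "exp (- c * (x - s)) - exp (- c * (x' - s)) = exp (- c * (x - s)) * (1 - exp (- c * (x' - x)))"
      by (simp only: exp_add right_diff_distrib mult_1_right)
    also have "\<dots> \<le> 1 * (c * (x' - x))"
    proof (rule mult_mono)
      show "exp (- c * (x - s)) \<le> 1" using that rate_nonneg by simp
      show "1 - exp (- c * (x' - x)) \<le> c * (x' - x)"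
        using exp_ge_add_one_self[of "- c * (x' - x)"] by linarith
      show "0 \<le> 1 - exp (- c * (x' - x))" using that rate_nonneg by simp
    qed simp
    finally have "exp (- c * (x - s)) - exp (- c * (x' - s)) \<le> c * (x' - x)" by simp
    moreover have "exp (- c * (x' - s)) \<le> exp (- c * (x - s))"
      using that rate_nonneg by (simp add: mult_left_mono)
    ultimately show ?thesis by simp
  qed
  have p_lip: "norm (p x' - p x) \<le> (2 * c * H) * (x' - x)" if "s \<le> x" "x \<le> x'" "x' \<le> t" for x x'
  proof -
    have "p x' - p x = exp (- c * (x' - s)) *\<^sub>R (y x' - y x)
        + (exp (- c * (x' - s)) - exp (- c * (x - s))) *\<^sub>R y x"
      by (simp add: p_def algebra_simps)
    also have "norm \<dots> \<le> exp (- c * (x' - s)) * norm (y x' - y x)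
        + \<bar>exp (- c * (x' - s)) - exp (- c * (x - s))\<bar> * norm (y x)"
      by (intro order_trans[OF norm_triangle_ineq]) simp
    also have "\<dots> \<le> 1 * (c * H * (x' - x)) + (c * (x' - x)) * H"
    proof (intro add_mono mult_mono)
      show "exp (- c * (x' - s)) \<le> 1" using that rate_nonneg by simp
      show "norm (y x) \<le> H" using that by (intro yH) simp
      show "0 \<le> c * (x' - x)" using that rate_nonneg by simp
      show "\<bar>exp (- c * (x' - s)) - exp (- c * (x - s))\<bar> \<le> c * (x' - x)"
        using that by (intro exp_lip)
      show "norm (y x' - y x) \<le> c * H * (x' - x)" using that by (intro y_lip)
    qed simp_all
    also have "\<dots> = (2 * c * H) * (x' - x)" by (simp add: algebra_simps)
    finally show ?thesis .
  qed
  have "(2 * c * H)-lipschitz_on {s..t} p"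
  proof (rule lipschitz_on_leI)
    fix x x' assume "x \<in> {s..t}" "x' \<in> {s..t}" "x \<le> x'"
    then have "norm (p x' - p x) \<le> 2 * c * H * (x' - x)" by (intro p_lip) auto
    then show "dist (p x) (p x') \<le> 2 * c * H * dist x x'"
      using \<open>x \<le> x'\<close> by (simp add: dist_norm norm_minus_commute[of "p x" "p x'"])
  qed (use rate_nonneg \<open>H \<ge> 0\<close> in simp)
  then have ac: "abs_continuous_on_interval s t p"
    by (rule lipschitz_on_imp_abs_continuous_on_interval)
  \<comment> \<open>The differentiation result requires the base point to be strictly below
    \<open>r\<close>, so the left endpoint is discarded as a null set.\<close>
  have "AE r in lebesgue. r \<noteq> s"
    by (rule AE_I'[of "{s}"]) (auto simp: negligible_iff_null_sets[symmetric])
  then have "AE r in lebesgue. r \<in> {s..t} \<longrightarrow>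
        (\<exists>w. (p has_vector_derivative w) (at r) \<and> \<delta> *\<^sub>R w = transpose (Q (\<phi> r)) *v p r)"
    using indefinite_integral_has_vector_derivative_AE[OF int]
  proof eventually_elim
    case (elim r)
    show ?case
    proof
      assume r: "r \<in> {s..t}"
      then have "((\<lambda>t. integral {s..t} (\<lambda>r. B r *v y r)) has_vector_derivative B r *v y r) (at r)"
        using elim by auto
      then have "(y has_vector_derivative B r *v y r) (at r)"
        by (subst eq[abs_def]) (auto intro!: derivative_eq_intros)
      then have "(p has_vector_derivative
          exp (- c * (r - s)) *\<^sub>R (B r *v y r) + (- c * exp (- c * (r - s))) *\<^sub>R y r) (at r)"
        unfolding p_def[abs_def] by (intro has_vector_derivative_scaleR) (auto intro!: derivative_eq_intros)
      moreover have "\<delta> *\<^sub>R (exp (- c * (r - s)) *\<^sub>R (B r *v y r) + (- c * exp (- c * (r - s))) *\<^sub>R y r)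
          = transpose (Q (\<phi> r)) *v p r"
        unfolding p_def matrix_vector_mult_scaleR B[OF r] by (simp add: algebra_simps)
      ultimately show "\<exists>w. (p has_vector_derivative w) (at r) \<and> \<delta> *\<^sub>R w = transpose (Q (\<phi> r)) *v p r"
        by blast
    qed
  qed
  with ac have sol: "caratheodory_solution Q \<delta> \<phi> s t p"
    by (simp add: caratheodory_solution_def)
  have init: "p s = v" using eq[of s] by (simp add: p_def)
  have "exp (- c * (t - s)) * (v $ k + b * (t - s) * v $ j) \<le> p t $ k"
    if b: "\<forall>r\<in>{s..t}. b \<le> B r $ k $ j" for k j b
  proof -
    have "((\<lambda>r. b * v $ j) has_integral b * v $ j * (t - s)) {s..t}"
      using has_integral_const_real[of "b * v $ j" s t] \<open>s \<le> t\<close> by (simp add: mult.commute)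
    then have "b * (t - s) * v $ j = integral {s..t} (\<lambda>r. b * v $ j)"
      by (subst integral_unique) (auto simp: mult_ac)
    also have "\<dots> \<le> integral {s..t} (\<lambda>r. (B r *v y r) $ k)"
    proof (intro integral_le integrable_on_vec_nth int integrable_const_ivl)
      fix r assume "r \<in> {s..t}"
      then have "b * v $ j \<le> B r $ k $ j * v $ j"
        using b v_nonneg by (intro mult_right_mono) auto
      also have "\<dots> \<le> B r $ k $ j * y r $ j"
        using low B_nonneg by (intro mult_left_mono) auto
      also have "\<dots> \<le> (B r *v y r) $ k"
        unfolding matrix_vector_mult_def
        using B_nonneg y_nonneg by (auto intro: member_le_sum[where f = "\<lambda>j. B r $ k $ j * y r $ j"])
      finally show "b * v $ j \<le> (B r *v y r) $ k" .
    qed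
    finally have "v $ k + b * (t - s) * v $ j \<le> y t $ k"
      using eq[of t] int by simp
    then show ?thesis by (simp add: p_def)
  qed
  then show ?thesis using sol init by blast
qed

end

end

section \<open>Superposition, restriction and uniqueness of solutions\<close>

lemma caratheodory_solution_add:
  assumes "caratheodory_solution Q \<delta> \<phi> s t p" "caratheodory_solution Q \<delta> \<phi> s t q"
  shows "caratheodory_solution Q \<delta> \<phi> s t (\<lambda>r. p r + q r)"
proof -
  have "AE r in lebesgue. r \<in> {s..t} \<longrightarrow>
        (\<exists>v. (p has_vector_derivative v) (at r) \<and> \<delta> *\<^sub>R v = transpose (Q (\<phi> r)) *v p r)"
    "AE r in lebesgue. r \<in> {s..t} \<longrightarrow>
        (\<exists>v. (q has_vector_derivative v) (at r) \<and> \<delta> *\<^sub>R v = transpose (Q (\<phi> r)) *v q r)"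
    using assms by (auto simp: caratheodory_solution_def)
  then have "AE r in lebesgue. r \<in> {s..t} \<longrightarrow> (\<exists>v. ((\<lambda>r. p r + q r) has_vector_derivative v) (at r) \<and>
        \<delta> *\<^sub>R v = transpose (Q (\<phi> r)) *v (p r + q r))"
  proof eventually_elim
    case (elim r)
    show ?case
    proof
      assume "r \<in> {s..t}"
      then obtain v w where v: "(p has_vector_derivative v) (at r)" "\<delta> *\<^sub>R v = transpose (Q (\<phi> r)) *v p r"
        and w: "(q has_vector_derivative w) (at r)" "\<delta> *\<^sub>R w = transpose (Q (\<phi> r)) *v q r"
        using elim by blast
      have "((\<lambda>r. p r + q r) has_vector_derivative v + w) (at r)"
        using v(1) w(1) by (rule has_vector_derivative_add)
      moreover have "\<delta> *\<^sub>R (v + w) = transpose (Q (\<phi> r)) *v (p r + q r)"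
        by (simp only: scaleR_right_distrib v(2) w(2) matrix_vector_right_distrib)
      ultimately show "\<exists>v. ((\<lambda>r. p r + q r) has_vector_derivative v) (at r) \<and>
          \<delta> *\<^sub>R v = transpose (Q (\<phi> r)) *v (p r + q r)" by blast
    qed
  qed
  then show ?thesis
    using assms abs_continuous_on_interval_add by (auto simp: caratheodory_solution_def)
qed

lemma caratheodory_solution_scaleR:
  assumes "caratheodory_solution Q \<delta> \<phi> s t p"
  shows "caratheodory_solution Q \<delta> \<phi> s t (\<lambda>r. a *\<^sub>R p r)"
proof -
  have "AE r in lebesgue. r \<in> {s..t} \<longrightarrow>
        (\<exists>v. (p has_vector_derivative v) (at r) \<and> \<delta> *\<^sub>R v = transpose (Q (\<phi> r)) *v p r)"
    using assms by (auto simp: caratheodory_solution_def)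
  then have "AE r in lebesgue. r \<in> {s..t} \<longrightarrow> (\<exists>v. ((\<lambda>r. a *\<^sub>R p r) has_vector_derivative v) (at r) \<and>
        \<delta> *\<^sub>R v = transpose (Q (\<phi> r)) *v (a *\<^sub>R p r))"
  proof eventually_elim
    case (elim r)
    show ?case
    proof
      assume "r \<in> {s..t}"
      then obtain v where v: "(p has_vector_derivative v) (at r)" "\<delta> *\<^sub>R v = transpose (Q (\<phi> r)) *v p r"
        using elim by blast
      have "((\<lambda>r. a *\<^sub>R p r) has_vector_derivative a *\<^sub>R v) (at r)"
        using v(1) by (auto intro!: derivative_eq_intros)
      moreover have "\<delta> *\<^sub>R (a *\<^sub>R v) = transpose (Q (\<phi> r)) *v (a *\<^sub>R p r)"
        by (simp only: scaleR_left_commute[of \<delta> a] v(2) matrix_vector_mult_scaleR)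
      ultimately show "\<exists>v. ((\<lambda>r. a *\<^sub>R p r) has_vector_derivative v) (at r) \<and>
          \<delta> *\<^sub>R v = transpose (Q (\<phi> r)) *v (a *\<^sub>R p r)" by blast
    qed
  qed
  then show ?thesis
    using assms abs_continuous_on_interval_bounded_linear[OF _ bounded_linear_scaleR_right]
    by (auto simp: caratheodory_solution_def)
qed

lemma caratheodory_solution_sum:
  assumes "finite I" "s \<le> t" "\<And>i. i \<in> I \<Longrightarrow> caratheodory_solution Q \<delta> \<phi> s t (p i)"
  shows "caratheodory_solution Q \<delta> \<phi> s t (\<lambda>r. \<Sum>i\<in>I. p i r)"
  using assms
proof (induction I rule: finite_induct)
  case empty
  show ?case
    by (auto simp: caratheodory_solution_def abs_continuous_on_interval_const intro!: exI[of _ 0])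
next
  case (insert i I)
  then show ?case using caratheodory_solution_add[of Q \<delta> \<phi> s t "p i"] by simp
qed

lemma caratheodory_solution_subset:
  assumes "caratheodory_solution Q \<delta> \<phi> s t p" "s \<le> s'" "t' \<le> t"
  shows "caratheodory_solution Q \<delta> \<phi> s' t' p"
proof -
  have "AE r in lebesgue. r \<in> {s..t} \<longrightarrow>
        (\<exists>v. (p has_vector_derivative v) (at r) \<and> \<delta> *\<^sub>R v = transpose (Q (\<phi> r)) *v p r)"
    using assms by (auto simp: caratheodory_solution_def)
  then have "AE r in lebesgue. r \<in> {s'..t'} \<longrightarrow>
        (\<exists>v. (p has_vector_derivative v) (at r) \<and> \<delta> *\<^sub>R v = transpose (Q (\<phi> r)) *v p r)"
    by eventually_elim (use assms in auto)
  then show ?thesis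
    using assms abs_continuous_on_interval_subset by (auto simp: caratheodory_solution_def)
qed

text \<open>On a window of length 1 / (2 L) that starts at a zero of \<open>p\<close>, the maximum m
  of \<open>norm (p r)\<close> satisfies m \<le> L m / (2 L) = m / 2 and hence vanishes. Marching
  through such windows reaches \<open>t\<close>.\<close>

lemma caratheodory_solution_eq_zero:
  assumes sol: "caratheodory_solution Q \<delta> \<phi> s t p" and "s \<le> t" "\<delta> > 0"
    and K: "\<And>r x. r \<in> {s..t} \<Longrightarrow> norm (transpose (Q (\<phi> r)) *v x) \<le> K * norm x"
    and "p s = 0"
  shows "p t = 0"
proof -
  \<comment> \<open>The summand 1 makes \<open>L\<close> positive even for \<open>K = 0\<close>, so
    that \<open>h\<close> is a genuine window length.\<close>
  define L where "L = \<bar>K\<bar> / \<delta> + 1"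
  have "L > 0" using \<open>\<delta> > 0\<close> by (simp add: L_def add_nonneg_pos)
  define h where "h = 1 / (2 * L)"
  have "h > 0" using \<open>L > 0\<close> by (simp add: h_def)
  have ac: "abs_continuous_on_interval s t p" using sol by (simp add: caratheodory_solution_def)
  have step: "p w = 0" if u: "s \<le> u" "u \<le> t" "p u = 0" and w: "u \<le> w" "w \<le> t" "w \<le> u + h" for u w
  proof -
    have "continuous_on {u..w} (\<lambda>r. norm (p r))"
      using abs_continuous_on_interval_imp_continuous_on[OF ac] u w
      by (intro continuous_on_norm) (auto intro: continuous_on_subset)
    then obtain x where x: "x \<in> {u..w}" "\<And>r. r \<in> {u..w} \<Longrightarrow> norm (p r) \<le> norm (p x)"
      using continuous_attains_sup[of "{u..w}" "\<lambda>r. norm (p r)"] w by auto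
    have "norm (p x - p u) \<le> (L * norm (p x)) * (x - u)"
    proof (rule abs_continuous_on_interval_derivative_bound)
      show "abs_continuous_on_interval u x p"
        using ac by (rule abs_continuous_on_interval_subset) (use x u w in auto)
      have "AE r in lebesgue. r \<in> {s..t} \<longrightarrow>
          (\<exists>v. (p has_vector_derivative v) (at r) \<and> \<delta> *\<^sub>R v = transpose (Q (\<phi> r)) *v p r)"
        using sol by (simp add: caratheodory_solution_def)
      then show "AE r in lebesgue. r \<in> {u..x} \<longrightarrow>
          (\<exists>v. (p has_vector_derivative v) (at r) \<and> norm v \<le> L * norm (p x))"
      proof eventually_elim
        case (elim r)
        show ?case
        proof
          assume r: "r \<in> {u..x}"
          then obtain v where v: "(p has_vector_derivative v) (at r)"
              "\<delta> *\<^sub>R v = transpose (Q (\<phi> r)) *v p r"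
            using elim u w x by auto
          have "\<delta> * norm v = norm (transpose (Q (\<phi> r)) *v p r)"
            using v(2) \<open>\<delta> > 0\<close> by (metis abs_of_pos norm_scaleR)
          also have "\<dots> \<le> K * norm (p r)" using r u w x by (intro K) auto
          also have "\<dots> \<le> \<bar>K\<bar> * norm (p x)" using r x by (intro mult_mono) auto
          also have "\<dots> \<le> \<delta> * (L * norm (p x))"
            using \<open>\<delta> > 0\<close> by (simp add: L_def algebra_simps)
          finally have "norm v \<le> L * norm (p x)" using \<open>\<delta> > 0\<close> by simp
          then show "\<exists>v. (p has_vector_derivative v) (at r) \<and> norm v \<le> L * norm (p x)"
            using v by blast
        qed
      qed
    qed (use x \<open>L > 0\<close> in auto)
    also have "\<dots> \<le> (L * norm (p x)) * h"
      using x w \<open>L > 0\<close> by (intro mult_left_mono) auto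
    also have "\<dots> = norm (p x) / 2" using \<open>L > 0\<close> by (simp add: h_def)
    finally have "norm (p x) = 0" using u by simp
    then show ?thesis using x(2)[of w] w by simp
  qed
  \<comment> \<open>The minimum cuts off the last window at \<open>t\<close>.\<close>
  have "p (min t (s + real n * h)) = 0" for n
  proof (induction n)
    case 0
    then show ?case using \<open>s \<le> t\<close> \<open>p s = 0\<close> by (simp add: min_def)
  next
    case (Suc n)
    have "s + real (Suc n) * h = s + real n * h + h" by (simp add: algebra_simps)
    moreover have "0 \<le> real n * h" using \<open>h > 0\<close> by simp
    ultimately show ?case
      using \<open>s \<le> t\<close> \<open>h > 0\<close> by (intro step[OF _ _ Suc]) auto
  qed
  moreover obtain n where "t - s < real n * h" using \<open>h > 0\<close> ex_less_of_nat_mult by blast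
  then have "min t (s + real n * h) = t" by simp
  ultimately show ?thesis by metis
qed


section \<open>Evolution matrices of bounded rate families\<close>

lemma matrix_eq_columnI:
  fixes A :: "real ^ 'n ^ 'm"
  assumes "\<And>j. A *v axis j 1 = B *v axis j 1"
  shows "A = B"
  using assms by (simp add: vec_eq_iff matrix_vector_mult_basis column_def)

lemma axis_one_nonneg: "0 \<le> axis j (1::real) $ i"
  by (simp add: axis_def)

text \<open>The entry bound feeds the uniqueness argument; the diagonal bound is what makes the
  shift by \<open>q\<close> produce a nonnegative matrix.\<close>

lemma rate_matrix_diag_bound:
  assumes "rate_matrix A" "(\<Sum>j\<in>UNIV - {i}. A $ i $ j) \<le> q"
  shows "\<bar>A $ i $ j\<bar> \<le> q" "0 \<le> A $ i $ i + q"
proof -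
  have off: "0 \<le> A $ i $ j" if "j \<noteq> i" for j using assms(1) that by (auto simp: rate_matrix_def)
  have diag: "A $ i $ i = - (\<Sum>j\<in>UNIV - {i}. A $ i $ j)" using assms(1) by (auto simp: rate_matrix_def)
  have s: "0 \<le> (\<Sum>j\<in>UNIV - {i}. A $ i $ j)" using off by (intro sum_nonneg) auto
  show "\<bar>A $ i $ j\<bar> \<le> q"
  proof (cases "j = i")
    case False
    then have "A $ i $ j \<le> (\<Sum>j\<in>UNIV - {i}. A $ i $ j)"
      using off by (intro member_le_sum) auto
    then show ?thesis using off[OF False] assms(2) by simp
  qed (use diag s assms(2) in simp)
  show "0 \<le> A $ i $ i + q" using diag assms(2) by simp
qed

lemma rate_matrix_row_sum:
  assumes "rate_matrix A"
  shows "(\<Sum>j\<in>UNIV. A $ i $ j) = 0"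
  using assms by (subst sum.remove[of UNIV i]) (auto simp: rate_matrix_def)

text \<open>\<open>q\<close> may be any common bound of the exit rates; the theorem later takes
  their supremum. Closedness of \<open>\<Theta>\<close> and continuity of the rates make the
  coefficients along a measurable path measurable.\<close>

locale bounded_rate_family =
  fixes Q :: "real ^ 'd \<Rightarrow> real ^ 'n ^ 'n" and \<Theta> :: "(real ^ 'd) set" and q :: real
  assumes closed_params: "closed \<Theta>"
    and continuous_rates: "continuous_on \<Theta> Q"
    and rates: "\<theta> \<in> \<Theta> \<Longrightarrow> rate_matrix (Q \<theta>)"
    and exit_rate_le: "\<theta> \<in> \<Theta> \<Longrightarrow> (\<Sum>j\<in>UNIV - {i}. Q \<theta> $ i $ j) \<le> q"
begin

text \<open>Two extensions by hand: \<open>Q\<close> is continuous on \<open>\<Theta>\<close> alone,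
  so it is cut off by the indicator of this closed set to become a Borel function \<open>F\<close>;
  the path is constrained on the nonnegative half-line alone, so it is frozen at
  \<open>\<phi> 0\<close> before time 0. The coefficients are then rate matrices at every real
  time.\<close>

lemma rate_along_path_measurable:
  assumes "measurable_path \<Theta> \<phi>"
  shows "(\<lambda>r. Q (if 0 \<le> r then \<phi> r else \<phi> 0) $ i $ j) \<in> borel_measurable lebesgue"
proof -
  define F where "F x = indicator \<Theta> x *\<^sub>R (Q x $ i $ j)" for x
  have "F \<in> borel_measurable borel"
    unfolding F_def[abs_def] using closed_params continuous_rates
    by (intro borel_measurable_continuous_on_indicator continuous_on_component) auto
  moreover have "\<phi> \<in> borel_measurable (lebesgue_on {0..})"
    using assms by (simp add: measurable_path_def)
  ultimately have "(\<lambda>r. F (\<phi> r)) \<in> borel_measurable (lebesgue_on {0..})"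
    by (rule measurable_compose[rotated])
  then have "(\<lambda>r. if r \<in> {0..} then F (\<phi> r) else 0) \<in> borel_measurable lebesgue"
    by (rule borel_measurable_if_I) simp
  moreover have "(\<lambda>r. indicator {..<0::real} r * Q (\<phi> 0) $ i $ j) \<in> borel_measurable lebesgue"
    by (intro borel_measurable_times borel_measurable_indicator borel_measurable_const
        sets_completionI_sets) simp
  ultimately have "(\<lambda>r. (if r \<in> {0..} then F (\<phi> r) else 0) + indicator {..<0} r * Q (\<phi> 0) $ i $ j)
      \<in> borel_measurable lebesgue"
    by (rule borel_measurable_add)
  also have "(\<lambda>r. (if r \<in> {0..} then F (\<phi> r) else 0) + indicator {..<0} r * Q (\<phi> 0) $ i $ j)
      = (\<lambda>r. Q (if 0 \<le> r then \<phi> r else \<phi> 0) $ i $ j)"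
    using assms by (auto simp: F_def measurable_path_def)
  finally show ?thesis .
qed

section \<open>Solutions along a fixed path and their evolution matrix\<close>

context
  fixes \<phi> :: "real \<Rightarrow> real ^ 'd" and \<delta> :: real
  assumes path: "measurable_path \<Theta> \<phi>" and \<delta>: "\<delta> > 0"
begin

lemma path_in: "0 \<le> r \<Longrightarrow> \<phi> r \<in> \<Theta>"
  using path by (simp add: measurable_path_def)

lemma nonneg_solution:
  assumes st: "0 \<le> s" "s \<le> t" and v: "\<And>i. 0 \<le> v $ i"
  obtains p where "caratheodory_solution Q \<delta> \<phi> s t p" "p s = v"
    "\<And>k j b. (\<And>\<theta>. \<theta> \<in> \<Theta> \<Longrightarrow> b \<le> Q \<theta> $ j $ k + (if j = k then q else 0)) \<Longrightarrow>
        exp (- q * (t - s) / \<delta>) * (v $ k + b * (t - s) / \<delta> * v $ j) \<le> p t $ k"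
proof -
  define \<psi> where "\<psi> r = (if 0 \<le> r then \<phi> r else \<phi> 0)" for r
  \<comment> \<open>This is uniformization: the zero row sums of the rates turn the shift by
    \<open>q\<close> into the constant column sum \<open>q / \<delta>\<close>.\<close>
  define B where "B r = (1 / \<delta>) *\<^sub>R (transpose (Q (\<psi> r)) + q *\<^sub>R mat 1)" for r
  have \<psi>: "\<psi> r \<in> \<Theta>" for r by (simp add: \<psi>_def path_in)
  have Bnth: "B r $ i $ j = (Q (\<psi> r) $ j $ i + (if j = i then q else 0)) / \<delta>" for r i j
    by (auto simp: B_def transpose_def mat_def add_divide_distrib)
  have meas: "(\<lambda>r. B r $ i $ j) \<in> borel_measurable lebesgue" for i j
    unfolding Bnth using rate_along_path_measurable[OF path, of j i] by (simp add: \<psi>_def)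
  have nonneg: "0 \<le> B r $ i $ j" for r i j
  proof -
    have "0 \<le> Q (\<psi> r) $ j $ i + (if j = i then q else 0)"
      using rates[OF \<psi>[of r]] rate_matrix_diag_bound(2)[OF rates exit_rate_le, OF \<psi>[of r] \<psi>[of r]]
      by (cases "j = i") (simp_all add: rate_matrix_def)
    then show ?thesis unfolding Bnth using \<delta> by simp
  qed
  have colsum: "(\<Sum>i\<in>UNIV. B r $ i $ j) = q / \<delta>" for r j
    unfolding Bnth sum_divide_distrib[symmetric]
    by (simp add: sum.distrib rate_matrix_row_sum[OF rates[OF \<psi>]])
  have Beq: "transpose (Q (\<phi> r)) *v x = \<delta> *\<^sub>R (B r *v x - (q / \<delta>) *\<^sub>R x)" if "r \<in> {s..t}" for r x
  proof -
    have "\<psi> r = \<phi> r" using that st by (simp add: \<psi>_def)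
    moreover have "B r *v x = (1 / \<delta>) *\<^sub>R (transpose (Q (\<psi> r)) *v x + q *\<^sub>R x)"
      unfolding B_def by (simp only: scaleR_matrix_vector_assoc[symmetric] matrix_vector_mult_add_rdistrib matrix_vector_mul_lid)
    ultimately show ?thesis using \<delta> by (simp add: algebra_simps)
  qed
  obtain p where p: "caratheodory_solution Q \<delta> \<phi> s t p" "p s = v"
    "\<forall>k j b. (\<forall>r\<in>{s..t}. b \<le> B r $ k $ j) \<longrightarrow>
        exp (- (q / \<delta>) * (t - s)) * (v $ k + b * (t - s) * v $ j) \<le> p t $ k"
    using caratheodory_solution_nonneg_exists[OF meas nonneg colsum v st(2) \<delta>, of Q \<phi>] Beq by blast
  have "exp (- q * (t - s) / \<delta>) * (v $ k + b * (t - s) / \<delta> * v $ j) \<le> p t $ k"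
    if "\<And>\<theta>. \<theta> \<in> \<Theta> \<Longrightarrow> b \<le> Q \<theta> $ j $ k + (if j = k then q else 0)" for k j b
  proof -
    have "b / \<delta> \<le> B r $ k $ j" for r
      unfolding Bnth using that[OF \<psi>[of r]] \<delta> by (intro divide_right_mono) auto
    then have "exp (- (q / \<delta>) * (t - s)) * (v $ k + b / \<delta> * (t - s) * v $ j) \<le> p t $ k"
      using p(3) by blast
    then show ?thesis by simp
  qed
  then show thesis using that p(1,2) by blast
qed

lemma solution_unique:
  assumes st: "0 \<le> s" "s \<le> t"
    and "caratheodory_solution Q \<delta> \<phi> s t p" "caratheodory_solution Q \<delta> \<phi> s t p'" "p s = p' s"
  shows "p t = p' t"
proof -
  \<comment> \<open>Crude operator bound: each of the N * N entries has absolute value at most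
    \<open>q\<close>.\<close>
  define K where "K = real CARD('n) * real CARD('n) * q"
  have K: "norm (transpose (Q (\<phi> r)) *v x) \<le> K * norm x" if "r \<in> {s..t}" for r x
  proof -
    have "\<phi> r \<in> \<Theta>" using that st path_in by simp
    then have "onorm ((*v) (transpose (Q (\<phi> r)))) \<le> K"
      unfolding K_def using rate_matrix_diag_bound(1)[OF rates exit_rate_le]
      by (intro onorm_le_matrix_component) (simp add: transpose_def)
    then show ?thesis
      using onorm[OF matrix_vector_mul_bounded_linear, of "transpose (Q (\<phi> r))" x]
      by (meson mult_right_mono norm_ge_zero order_trans)
  qed
  have "caratheodory_solution Q \<delta> \<phi> s t (\<lambda>r. p r + (- 1) *\<^sub>R p' r)"
    using assms by (intro caratheodory_solution_add caratheodory_solution_scaleR)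
  from caratheodory_solution_eq_zero[OF this st(2) \<delta> K] have "p t + (- 1) *\<^sub>R p' t = 0"
    using assms(5) by simp
  then show ?thesis by simp
qed

text \<open>Makes the definite description in \<open>evolution_matrix\<close> meaningful. The matrix
  whose columns are the final values of the solutions started at the axis vectors works by
  superposition; it is the only one because those solutions determine every column.\<close>

lemma evolution_matrix_ex1:
  assumes st: "0 \<le> s" "s \<le> t"
  shows "\<exists>!M. \<forall>p. caratheodory_solution Q \<delta> \<phi> s t p \<longrightarrow> p t = M *v p s"
proof -
  have "\<exists>p. caratheodory_solution Q \<delta> \<phi> s t p \<and> p s = axis j 1" for j
    by (rule nonneg_solution[OF st axis_one_nonneg[of j]]) blast
  then obtain e where e: "\<And>j. caratheodory_solution Q \<delta> \<phi> s t (e j)" "\<And>j. e j s = axis j 1"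
    by metis
  show ?thesis
  proof (rule ex1I[of _ "\<chi> i j. e j t $ i"], intro allI impI)
    fix p assume p: "caratheodory_solution Q \<delta> \<phi> s t p"
    have "p t = (\<Sum>j\<in>UNIV. p s $ j *\<^sub>R e j t)"
    proof (rule solution_unique[OF st p])
      show "caratheodory_solution Q \<delta> \<phi> s t (\<lambda>r. \<Sum>j\<in>UNIV. p s $ j *\<^sub>R e j r)"
        using st e by (intro caratheodory_solution_sum caratheodory_solution_scaleR) auto
      show "p s = (\<Sum>j\<in>UNIV. p s $ j *\<^sub>R e j s)"
        using basis_expansion[of "p s"] by (simp add: e scalar_mult_eq_scaleR)
    qed
    also have "\<dots> = (\<chi> i j. e j t $ i) *v p s"
      by (simp add: vec_eq_iff matrix_vector_mult_def mult.commute)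
    finally show "p t = (\<chi> i j. e j t $ i) *v p s" .
  next
    fix M assume M: "\<forall>p. caratheodory_solution Q \<delta> \<phi> s t p \<longrightarrow> p t = M *v p s"
    then have "M *v axis j 1 = e j t" for j using e by metis
    then show "M = (\<chi> i j. e j t $ i)"
      by (intro matrix_eq_columnI) (simp add: matrix_vector_mult_basis column_def vec_eq_iff)
  qed
qed

lemma evolution_matrix_solution:
  assumes "0 \<le> s" "s \<le> t" "caratheodory_solution Q \<delta> \<phi> s t p"
  shows "evolution_matrix Q \<delta> \<phi> t s *v p s = p t"
  using theI'[OF evolution_matrix_ex1[OF assms(1,2)]] assms(3) by (simp add: evolution_matrix_def)

lemma evolution_matrix_eqI:
  assumes "0 \<le> s" "s \<le> t"
    and "\<And>p. caratheodory_solution Q \<delta> \<phi> s t p \<Longrightarrow> p t = M *v p s"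
  shows "evolution_matrix Q \<delta> \<phi> t s = M"
  unfolding evolution_matrix_def
  using assms by (intro the1_equality evolution_matrix_ex1) auto

text \<open>Solutions on \<open>{s..t}\<close> are only restricted, never glued: the matrix on the
  left is identified by its action on such solutions, and each restriction is a solution on its
  part.\<close>

lemma evolution_matrix_comp:
  assumes "0 \<le> s" "s \<le> r" "r \<le> t"
  shows "evolution_matrix Q \<delta> \<phi> t s = evolution_matrix Q \<delta> \<phi> t r ** evolution_matrix Q \<delta> \<phi> r s"
proof (rule evolution_matrix_eqI)
  fix p assume p: "caratheodory_solution Q \<delta> \<phi> s t p"
  have "caratheodory_solution Q \<delta> \<phi> s r p" "caratheodory_solution Q \<delta> \<phi> r t p"
    using assms caratheodory_solution_subset[OF p] by auto
  then have "evolution_matrix Q \<delta> \<phi> r s *v p s = p r" "evolution_matrix Q \<delta> \<phi> t r *v p r = p t"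
    using assms by (auto intro!: evolution_matrix_solution)
  then show "p t = (evolution_matrix Q \<delta> \<phi> t r ** evolution_matrix Q \<delta> \<phi> r s) *v p s"
    by (simp add: matrix_vector_mul_assoc[symmetric])
qed (use assms in auto)

text \<open>The common source of lower bounds: \<open>b = 0\<close> with \<open>j = k\<close> gives
  nonnegativity and the case of a column started in the target state, \<open>b = q_low\<close> the
  case of a column started elsewhere.\<close>

lemma evolution_matrix_entry_ge:
  assumes st: "0 \<le> s" "s \<le> t"
    and b: "\<And>\<theta>. \<theta> \<in> \<Theta> \<Longrightarrow> b \<le> Q \<theta> $ j $ k + (if j = k then q else 0)"
  shows "exp (- q * (t - s) / \<delta>) * (axis i 1 $ k + b * (t - s) / \<delta> * axis i 1 $ j)
      \<le> evolution_matrix Q \<delta> \<phi> t s $ k $ i"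
proof -
  obtain p where p: "caratheodory_solution Q \<delta> \<phi> s t p" "p s = axis i 1"
    "exp (- q * (t - s) / \<delta>) * (axis i 1 $ k + b * (t - s) / \<delta> * axis i 1 $ j) \<le> p t $ k"
    by (rule nonneg_solution[OF st axis_one_nonneg[of i]]) (use b in blast)
  have "p t = evolution_matrix Q \<delta> \<phi> t s *v axis i 1"
    using evolution_matrix_solution[OF st p(1)] p(2) by simp
  then show ?thesis using p(3) by (simp add: matrix_vector_mult_basis column_def)
qed

lemma evolution_matrix_nonneg:
  assumes st: "0 \<le> s" "s \<le> t"
  shows "0 \<le> evolution_matrix Q \<delta> \<phi> t s $ k $ i"
proof -
  have "0 \<le> Q \<theta> $ k $ k + q" if "\<theta> \<in> \<Theta>" for \<theta>
    using rate_matrix_diag_bound(2)[OF rates exit_rate_le, OF that that] .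
  then have "exp (- q * (t - s) / \<delta>) * (axis i 1 $ k + 0 * (t - s) / \<delta> * axis i 1 $ k)
      \<le> evolution_matrix Q \<delta> \<phi> t s $ k $ i"
    by (intro evolution_matrix_entry_ge[OF st]) simp
  moreover have "0 \<le> exp (- q * (t - s) / \<delta>) * (axis i 1 $ k + 0 * (t - s) / \<delta> * axis i 1 $ k)"
    by (simp add: axis_one_nonneg)
  ultimately show ?thesis by linarith
qed

text \<open>Conservation of mass: the rows of a rate matrix sum to zero, so the coordinate sum of a
  solution has derivative zero almost everywhere. Being absolutely continuous, it is constant by the
  derivative bound with \<open>M = 0\<close>.\<close>

lemma evolution_matrix_column_sum:
  assumes st: "0 \<le> s" "s \<le> t"
  shows "(\<Sum>i\<in>UNIV. evolution_matrix Q \<delta> \<phi> t s $ i $ j) = 1"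
proof -
  obtain p where p: "caratheodory_solution Q \<delta> \<phi> s t p" "p s = axis j 1"
    by (rule nonneg_solution[OF st axis_one_nonneg[of j]]) blast
  have pt: "p t = evolution_matrix Q \<delta> \<phi> t s *v axis j 1"
    using evolution_matrix_solution[OF st p(1)] p(2) by simp
  let ?L = "\<lambda>x :: real ^ 'n. \<Sum>i\<in>UNIV. x $ i"
  have bl: "bounded_linear ?L"
    by (intro bounded_linear_sum bounded_linear_vec_nth)
  have "norm (?L (p t) - ?L (p s)) \<le> 0 * (t - s)"
  proof (rule abs_continuous_on_interval_derivative_bound)
    show "abs_continuous_on_interval s t (\<lambda>r. ?L (p r))"
      by (rule abs_continuous_on_interval_bounded_linear[OF _ bl])
        (use p(1) in \<open>simp add: caratheodory_solution_def\<close>)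
    have "AE r in lebesgue. r \<in> {s..t} \<longrightarrow>
        (\<exists>v. (p has_vector_derivative v) (at r) \<and> \<delta> *\<^sub>R v = transpose (Q (\<phi> r)) *v p r)"
      using p(1) by (simp add: caratheodory_solution_def)
    then show "AE r in lebesgue. r \<in> {s..t} \<longrightarrow>
        (\<exists>v. ((\<lambda>r. ?L (p r)) has_vector_derivative v) (at r) \<and> norm v \<le> 0)"
    proof eventually_elim
      case (elim r)
      show ?case
      proof
        assume r: "r \<in> {s..t}"
        then obtain v where v: "(p has_vector_derivative v) (at r)"
            "\<delta> *\<^sub>R v = transpose (Q (\<phi> r)) *v p r"
          using elim by blast
        have "((\<lambda>r. ?L (p r)) has_vector_derivative ?L v) (at r)"
          using bounded_linear.has_vector_derivative[OF bl v(1)] .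
        moreover have "\<delta> * ?L v = 0"
        proof -
          have "\<delta> * ?L v = ?L (\<delta> *\<^sub>R v)" by (simp add: sum_distrib_left)
          also have "\<dots> = (\<Sum>i\<in>UNIV. \<Sum>j\<in>UNIV. Q (\<phi> r) $ j $ i * p r $ j)"
            unfolding v(2) matrix_vector_mult_def by (simp add: transpose_def)
          also have "\<dots> = (\<Sum>j\<in>UNIV. \<Sum>i\<in>UNIV. Q (\<phi> r) $ j $ i * p r $ j)"
            by (rule sum.swap)
          also have "\<dots> = 0"
            using r st by (simp add: sum_distrib_right[symmetric] rate_matrix_row_sum rates path_in)
          finally show ?thesis .
        qed
        then have "?L v = 0" using \<delta> by simp
        ultimately show "\<exists>v. ((\<lambda>r. ?L (p r)) has_vector_derivative v) (at r) \<and> norm v \<le> 0"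
          by (intro exI[of _ "?L v"]) simp
      qed
    qed
  qed (use st in auto)
  then have "?L (p t) = 1" using p(2) by (simp add: axis_def)
  then show ?thesis by (simp add: pt matrix_vector_mult_basis column_def)
qed

end

end


section \<open>The matrix exponential as a solution\<close>

lemma has_vector_derivative_componentwise_cart:
  fixes f :: "real \<Rightarrow> real ^ 'n"
  assumes "\<And>i. ((\<lambda>t. f t $ i) has_real_derivative D $ i) (at t)"
  shows "(f has_vector_derivative D) (at t)"
  unfolding has_vector_derivative_def
proof (subst has_derivative_componentwise_within, intro ballI)
  fix b :: "real ^ 'n" assume "b \<in> Basis"
  then obtain i where b: "b = axis i 1" by (auto simp: Basis_vec_def)
  show "((\<lambda>x. f x \<bullet> b) has_derivative (\<lambda>x. (x *\<^sub>R D) \<bullet> b)) (at t)"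
    using assms[of i] by (simp add: b inner_axis has_field_derivative_def mult_commute_abs)
qed

lemma C1_imp_abs_continuous_on_interval:
  fixes f :: "real \<Rightarrow> 'a::real_normed_vector"
  assumes "\<And>x. (f has_vector_derivative f' x) (at x)" "continuous_on {a..b} f'"
  shows "abs_continuous_on_interval a b f"
proof -
  have "bounded (f' ` {a..b})"
    using assms(2) by (intro compact_imp_bounded compact_continuous_image) auto
  then obtain M where M: "M > 0" "\<And>x. x \<in> {a..b} \<Longrightarrow> norm (f' x) \<le> M"
    by (auto simp: bounded_pos)
  have "M-lipschitz_on {a..b} f"
  proof (rule lipschitz_onI)
    fix x y assume xy: "x \<in> {a..b}" "y \<in> {a..b}"
    have "norm (f x - f y) \<le> M * norm (x - y)"
    proof (rule differentiable_bound[of "{a..b}" f "\<lambda>x h. h *\<^sub>R f' x"])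
      show "(f has_derivative (\<lambda>h. h *\<^sub>R f' x)) (at x within {a..b})" for x
        using assms(1)[of x] unfolding has_vector_derivative_def by (rule has_derivative_at_withinI)
      show "onorm (\<lambda>h. h *\<^sub>R f' x) \<le> M" if "x \<in> {a..b}" for x
        using M(1) M(2)[OF that]
        by (intro onorm_bound) (auto simp: mult.commute[of M] intro: mult_left_mono)
    qed (use xy in auto)
    then show "dist (f x) (f y) \<le> M * dist x y" by (simp add: dist_norm)
  qed (use M in simp)
  then show ?thesis by (rule lipschitz_on_imp_abs_continuous_on_interval)
qed

section \<open>Entrywise power series of the matrix exponential\<close>

context
  fixes A :: "real ^ 'n ^ 'n"
begin

definition mpow :: "nat \<Rightarrow> real ^ 'n ^ 'n" where
  "mpow k = ((**) A ^^ k) (mat 1)"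

lemma mpow_0: "mpow 0 = mat 1"
  and mpow_Suc: "mpow (Suc k) = A ** mpow k"
  by (simp_all add: mpow_def)

text \<open>The sum of all absolute entries dominates every row sum, so one constant survives the
  induction and the exponential series becomes a majorant.\<close>

lemma mpow_entry_bound: "\<bar>mpow k $ i $ j\<bar> \<le> (\<Sum>i\<in>UNIV. \<Sum>j\<in>UNIV. \<bar>A $ i $ j\<bar>) ^ k"
proof (induction k arbitrary: i j)
  case 0
  show ?case by (simp add: mpow_0 mat_def)
next
  case (Suc k)
  let ?K = "\<Sum>i\<in>UNIV. \<Sum>j\<in>UNIV. \<bar>A $ i $ j\<bar>"
  have "\<bar>mpow (Suc k) $ i $ j\<bar> \<le> (\<Sum>l\<in>UNIV. \<bar>A $ i $ l\<bar> * \<bar>mpow k $ l $ j\<bar>)"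
    unfolding mpow_Suc matrix_matrix_mult_def by (simp add: sum_abs abs_mult[symmetric])
  also have "\<dots> \<le> (\<Sum>l\<in>UNIV. \<bar>A $ i $ l\<bar> * ?K ^ k)"
    using Suc by (intro sum_mono mult_left_mono) auto
  also have "\<dots> = (\<Sum>l\<in>UNIV. \<bar>A $ i $ l\<bar>) * ?K ^ k"
    by (simp add: sum_distrib_right)
  also have "\<dots> \<le> ?K * ?K ^ k"
    by (intro mult_right_mono member_le_sum[where f = "\<lambda>i. \<Sum>l\<in>UNIV. \<bar>A $ i $ l\<bar>"])
      (auto intro!: sum_nonneg zero_le_power)
  finally show ?case by simp
qed

lemma summable_mpow_entry: "summable (\<lambda>k. mpow k $ i $ j / fact k * t ^ k)"
proof (rule summable_comparison_test')
  let ?K = "\<Sum>i\<in>UNIV. \<Sum>j\<in>UNIV. \<bar>A $ i $ j\<bar>"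
  show "summable (\<lambda>k. inverse (fact k) * (?K * \<bar>t\<bar>) ^ k)" by (rule summable_exp)
  fix k :: nat
  have "norm (mpow k $ i $ j / fact k * t ^ k) = \<bar>mpow k $ i $ j\<bar> * (inverse (fact k) * \<bar>t\<bar> ^ k)"
    by (simp add: abs_mult power_abs divide_inverse)
  also have "\<dots> \<le> ?K ^ k * (inverse (fact k) * \<bar>t\<bar> ^ k)"
    by (intro mult_right_mono mpow_entry_bound) auto
  finally show "norm (mpow k $ i $ j / fact k * t ^ k) \<le> inverse (fact k) * (?K * \<bar>t\<bar>) ^ k"
    by (simp add: power_mult_distrib mult_ac)
qed

lemma power_scaleR_matrix: "((**) (t *\<^sub>R A) ^^ k) (mat 1) = t ^ k *\<^sub>R mpow k"
proof (induction k)
  case (Suc k)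
  then show ?case
    by (simp add: mpow_Suc vec_eq_iff matrix_matrix_mult_def sum_distrib_left mult_ac)
qed (simp add: mpow_0)

text \<open>Reduces the exponential to scalar power series in \<open>t\<close>, to which termwise
  differentiation applies.\<close>

lemma matrix_exp_nth: "matrix_exp (t *\<^sub>R A) $ i $ j = (\<Sum>k. mpow k $ i $ j / fact k * t ^ k)"
proof -
  have "(\<lambda>n. \<Sum>k<n. (1 / fact k) *\<^sub>R (t ^ k *\<^sub>R mpow k)) \<longlonglongrightarrow> (\<chi> i j. \<Sum>k. mpow k $ i $ j / fact k * t ^ k)"
    using summable_LIMSEQ[OF summable_mpow_entry]
    by (intro vec_tendstoI) (simp add: sum_component mult_ac divide_inverse)
  then have "(\<Sum>k. (1 / fact k) *\<^sub>R (t ^ k *\<^sub>R mpow k)) = (\<chi> i j. \<Sum>k. mpow k $ i $ j / fact k * t ^ k)"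
    by (intro sums_unique[symmetric]) (simp add: sums_def)
  then show ?thesis by (simp add: matrix_exp_def power_scaleR_matrix)
qed

lemma matrix_exp_0: "matrix_exp (0 *\<^sub>R A) = mat 1"
  unfolding vec_eq_iff matrix_exp_nth powser_zero by (simp add: mpow_0)

lemma matrix_exp_entry_has_derivative:
  "((\<lambda>t. matrix_exp (t *\<^sub>R A) $ i $ j) has_real_derivative (A ** matrix_exp (t *\<^sub>R A)) $ i $ j) (at t)"
proof -
  let ?c = "\<lambda>k. mpow k $ i $ j / fact k"
  have "diffs ?c k * t ^ k = (\<Sum>l\<in>UNIV. A $ i $ l * (mpow k $ l $ j / fact k * t ^ k))" for k
  proof -
    \<comment> \<open>Differentiation shifts the index and cancels one factor of the factorial; the
      extra factor in \<open>mpow (Suc k)\<close> is then pulled out as multiplication by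
      \<open>A\<close>.\<close>
    have c: "diffs ?c k = mpow (Suc k) $ i $ j / fact k"
      by (simp add: diffs_def del: of_nat_Suc)
    show ?thesis
      unfolding c mpow_Suc matrix_matrix_mult_def
      by (simp add: sum_divide_distrib sum_distrib_left mult_ac)
  qed
  then have "(\<Sum>k. diffs ?c k * t ^ k) = (\<Sum>l\<in>UNIV. \<Sum>k. A $ i $ l * (mpow k $ l $ j / fact k * t ^ k))"
    by (simp only:) (intro suminf_sum summable_mult summable_mpow_entry)
  also have "\<dots> = (A ** matrix_exp (t *\<^sub>R A)) $ i $ j"
    by (simp only: matrix_matrix_mult_def vec_lambda_beta matrix_exp_nth suminf_mult[OF summable_mpow_entry])
  finally show ?thesis
    unfolding matrix_exp_nth
    using termdiffs_strong_converges_everywhere[of ?c t] summable_mpow_entry by simp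
qed

lemma matrix_exp_has_vector_derivative:
  "((\<lambda>t. matrix_exp (t *\<^sub>R A) *v x) has_vector_derivative A *v (matrix_exp (t *\<^sub>R A) *v x)) (at t)"
proof (rule has_vector_derivative_componentwise_cart)
  fix i
  have "((\<lambda>t. \<Sum>j\<in>UNIV. matrix_exp (t *\<^sub>R A) $ i $ j * x $ j) has_real_derivative
      (\<Sum>j\<in>UNIV. (A ** matrix_exp (t *\<^sub>R A)) $ i $ j * x $ j)) (at t)"
    by (intro DERIV_sum DERIV_cmult_right matrix_exp_entry_has_derivative)
  then show "((\<lambda>t. (matrix_exp (t *\<^sub>R A) *v x) $ i) has_real_derivative
      (A *v (matrix_exp (t *\<^sub>R A) *v x)) $ i) (at t)"
    unfolding matrix_vector_mul_assoc by (simp add: matrix_vector_mult_def)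
qed

end

lemma matrix_exp_caratheodory_solution:
  "caratheodory_solution Q 1 (\<lambda>_. \<theta>) s t (\<lambda>r. matrix_exp (r *\<^sub>R transpose (Q \<theta>)) *v x)"
proof -
  let ?A = "transpose (Q \<theta>)"
  note deriv = matrix_exp_has_vector_derivative[of ?A x]
  have "continuous_on {s..t} (\<lambda>r. matrix_exp (r *\<^sub>R ?A) *v x)"
    using has_vector_derivative_continuous[OF deriv] by (simp add: continuous_at_imp_continuous_on)
  then have "continuous_on {s..t} (\<lambda>r. ?A *v (matrix_exp (r *\<^sub>R ?A) *v x))"
    by (rule bounded_linear.continuous_on[OF matrix_vector_mul_bounded_linear])
  with deriv have "abs_continuous_on_interval s t (\<lambda>r. matrix_exp (r *\<^sub>R ?A) *v x)"
    by (rule C1_imp_abs_continuous_on_interval)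
  then show ?thesis
    unfolding caratheodory_solution_def
    using deriv by (intro conjI AE_I2 impI exI[of _ "?A *v (matrix_exp (r *\<^sub>R ?A) *v x)" for r]) simp_all
qed

context bounded_rate_family
begin

lemma matrix_exp_eq_evolution_matrix:
  assumes "\<theta> \<in> \<Theta>" "0 \<le> t"
  shows "matrix_exp (t *\<^sub>R transpose (Q \<theta>)) *v x = evolution_matrix Q 1 (\<lambda>_. \<theta>) t 0 *v x"
proof -
  have "measurable_path \<Theta> (\<lambda>_. \<theta>)" using assms by (simp add: measurable_path_def)
  from evolution_matrix_solution[OF this zero_less_one order_refl assms(2) matrix_exp_caratheodory_solution, of x]
  show ?thesis by (simp only: matrix_exp_0 matrix_vector_mul_lid)
qed

end


section \<open>Contraction on zero-sum vectors\<close>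

lemma norm1_nonneg: "0 \<le> norm1 x"
  by (simp add: norm1_def sum_nonneg)

lemma norm1_pos:
  assumes "x \<noteq> 0"
  shows "0 < norm1 x"
proof -
  obtain i where "x $ i \<noteq> 0" using assms by (auto simp: vec_eq_iff)
  then show ?thesis unfolding norm1_def by (intro sum_pos2[of _ i]) auto
qed

lemma norm1_axis: "norm1 (axis j 1) = 1"
  by (simp add: norm1_def axis_def if_distrib[of abs] cong: if_cong)

text \<open>Testing with \<open>axis j 1\<close> produces column \<open>j\<close>. The real supremum
  dominates this value only once its range is known to be bounded, which is checked first; at
  \<open>x = 0\<close> the quotient is 0 by the convention for division.\<close>

lemma entry_le_opnorm1:
  fixes A :: "real ^ 'n ^ 'n"
  shows "\<bar>A $ i $ j\<bar> \<le> opnorm1 A"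
proof -
  let ?K = "\<Sum>i\<in>UNIV. \<Sum>j\<in>UNIV. \<bar>A $ i $ j\<bar>"
  have le: "norm1 (A *v x) \<le> ?K * norm1 x" for x
  proof -
    have "norm1 (A *v x) \<le> (\<Sum>i\<in>UNIV. \<Sum>j\<in>UNIV. \<bar>A $ i $ j\<bar> * \<bar>x $ j\<bar>)"
      unfolding norm1_def matrix_vector_mult_def
      by (intro sum_mono) (simp add: sum_abs abs_mult[symmetric])
    also have "\<dots> \<le> (\<Sum>i\<in>UNIV. \<Sum>j\<in>UNIV. \<bar>A $ i $ j\<bar> * norm1 x)"
      unfolding norm1_def by (intro sum_mono mult_left_mono member_le_sum) auto
    also have "\<dots> = ?K * norm1 x" by (simp add: sum_distrib_right)
    finally show ?thesis .
  qed
  have "bdd_above (range (\<lambda>x. norm1 (A *v x) / norm1 x))"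
  proof (rule bdd_aboveI2)
    fix x :: "real ^ 'n"
    show "norm1 (A *v x) / norm1 x \<le> ?K"
    proof (cases "x = 0")
      case False
      then show ?thesis by (intro mult_imp_div_pos_le norm1_pos le)
    next
      case True
      have "0 \<le> ?K" by (intro sum_nonneg) auto
      then show ?thesis using True by (simp add: norm1_def)
    qed
  qed
  then have "norm1 (A *v axis j 1) / norm1 (axis j 1 :: real ^ 'n) \<le> opnorm1 A"
    unfolding opnorm1_def by (rule cSUP_upper[rotated]) simp
  then have "norm1 (A *v axis j 1) \<le> opnorm1 A" by (simp add: norm1_axis)
  moreover have "\<bar>A $ i $ j\<bar> \<le> norm1 (A *v axis j 1)"
    unfolding norm1_def matrix_vector_mult_basis column_def
    using member_le_sum[of i UNIV "\<lambda>i. \<bar>A $ i $ j\<bar>"] by simp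
  ultimately show ?thesis by simp
qed

section \<open>Regularity of the rates on the parameter cube\<close>

lemma param_cube_eq_cbox: "param_cube R = cbox (\<chi> i. - R) (\<chi> i. R)"
  by (auto simp: param_cube_def mem_box_cart)

lemma continuous_on_opnorm1_lipschitz:
  fixes Q :: "real ^ 'd \<Rightarrow> real ^ 'n ^ 'n"
  assumes L: "\<And>\<theta> \<theta>'. \<theta> \<in> \<Theta> \<Longrightarrow> \<theta>' \<in> \<Theta> \<Longrightarrow>
    opnorm1 (transpose (Q \<theta>) - transpose (Q \<theta>')) \<le> L * norm (\<theta> - \<theta>')" and "L > 0"
  shows "continuous_on \<Theta> Q"
proof -
  have "continuous_on \<Theta> (\<lambda>\<theta>. Q \<theta> $ i $ j)" for i j
  proof (rule lipschitz_on_continuous_on[where L = L], rule lipschitz_onI)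
    fix \<theta> \<theta>' assume "\<theta> \<in> \<Theta>" "\<theta>' \<in> \<Theta>"
    then show "dist (Q \<theta> $ i $ j) (Q \<theta>' $ i $ j) \<le> L * dist \<theta> \<theta>'"
      using entry_le_opnorm1[of "transpose (Q \<theta>) - transpose (Q \<theta>')" j i] L[of \<theta> \<theta>']
      by (simp add: dist_norm transpose_def)
  qed (use \<open>L > 0\<close> in simp)
  then have "continuous_on \<Theta> (\<lambda>\<theta>. \<chi> i j. Q \<theta> $ i $ j)"
    by (intro continuous_on_vec_lambda)
  then show ?thesis by simp
qed

text \<open>A continuous \<open>Q\<close> on a compact set is bounded, so the set under the supremum
  is bounded above and the supremum really is an upper bound.\<close>

lemma exit_rate_le_max_exit_rate:
  assumes "compact \<Theta>" "continuous_on \<Theta> Q" "\<theta> \<in> \<Theta>"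
  shows "(\<Sum>j\<in>UNIV - {i}. Q \<theta> $ i $ j) \<le> max_exit_rate \<Theta> Q"
proof -
  have "bounded (Q ` \<Theta>)"
    using assms by (intro compact_imp_bounded compact_continuous_image)
  then obtain b where b: "\<And>\<theta>. \<theta> \<in> \<Theta> \<Longrightarrow> norm (Q \<theta>) \<le> b"
    by (auto simp: bounded_iff)
  have entry: "Q \<theta> $ i $ j \<le> b" if "\<theta> \<in> \<Theta>" for \<theta> i j
    using b[OF that] component_le_norm_cart[of "Q \<theta> $ i" j] Finite_Cartesian_Product.norm_nth_le[of "Q \<theta>" i]
    by linarith
  have "bdd_above ((\<lambda>\<theta>. Max (range (\<lambda>i. \<Sum>j\<in>UNIV - {i}. Q \<theta> $ i $ j))) ` \<Theta>)"
  proof (rule bdd_aboveI2)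
    fix \<theta> assume \<theta>: "\<theta> \<in> \<Theta>"
    have "(\<Sum>j\<in>UNIV - {i}. Q \<theta> $ i $ j) \<le> of_nat (card (UNIV - {i} :: 'b set)) * b" for i
      using entry[OF \<theta>] by (intro sum_bounded_above)
    then show "Max (range (\<lambda>i. \<Sum>j\<in>UNIV - {i}. Q \<theta> $ i $ j))
        \<le> Max (range (\<lambda>i :: 'b. of_nat (card (UNIV - {i})) * b))"
      by (subst Max_le_iff) (auto intro!: order_trans[OF _ Max_ge])
  qed
  then have "Max (range (\<lambda>i. \<Sum>j\<in>UNIV - {i}. Q \<theta> $ i $ j)) \<le> max_exit_rate \<Theta> Q"
    unfolding max_exit_rate_def using assms(3) by (intro cSUP_upper)
  moreover have "(\<Sum>j\<in>UNIV - {i}. Q \<theta> $ i $ j) \<le> Max (range (\<lambda>i. \<Sum>j\<in>UNIV - {i}. Q \<theta> $ i $ j))"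
    by (intro Max_ge) auto
  ultimately show ?thesis by linarith
qed

section \<open>Column-stochastic matrices on zero-sum vectors\<close>

lemma zero_sum_mult:
  assumes "\<And>j. (\<Sum>i\<in>UNIV. M $ i $ j) = 1" "\<xi> \<in> zero_sum"
  shows "M *v \<xi> \<in> zero_sum"
proof -
  have "(\<Sum>i\<in>UNIV. (M *v \<xi>) $ i) = (\<Sum>j\<in>UNIV. \<Sum>i\<in>UNIV. M $ i $ j * \<xi> $ j)"
    unfolding matrix_vector_mult_def by (subst sum.swap) simp
  also have "\<dots> = 0"
    using assms by (simp add: sum_distrib_right[symmetric] zero_sum_def)
  finally show ?thesis by (simp add: zero_sum_def)
qed

text \<open>Doeblin's argument: subtracting \<open>a\<close> from the \<open>k\<close>-th row does not change the action on
  \<open>zero_sum\<close> and leaves a nonnegative matrix with column sums \<open>1 - a\<close>.\<close>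

lemma doeblin_contraction:
  assumes nonneg: "\<And>i j. 0 \<le> M $ i $ j" and colsum: "\<And>j. (\<Sum>i\<in>UNIV. M $ i $ j) = 1"
    and minor: "\<And>j. a \<le> M $ k $ j" and \<xi>: "\<xi> \<in> zero_sum"
  shows "norm1 (M *v \<xi>) \<le> (1 - a) * norm1 \<xi>"
proof -
  let ?M = "\<lambda>i j. M $ i $ j - (if i = k then a else 0)"
  have M_nonneg: "0 \<le> ?M i j" for i j using nonneg minor by simp
  have "(M *v \<xi>) $ i = (\<Sum>j\<in>UNIV. ?M i j * \<xi> $ j)" for i
    using \<xi> by (simp add: matrix_vector_mult_def zero_sum_def left_diff_distrib sum_subtractf
        sum_distrib_left[symmetric])
  then have "norm1 (M *v \<xi>) \<le> (\<Sum>i\<in>UNIV. \<Sum>j\<in>UNIV. ?M i j * \<bar>\<xi> $ j\<bar>)"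
    unfolding norm1_def using M_nonneg
    by (auto intro!: sum_mono order_trans[OF sum_abs] simp: abs_mult)
  also have "\<dots> = (\<Sum>j\<in>UNIV. (\<Sum>i\<in>UNIV. ?M i j) * \<bar>\<xi> $ j\<bar>)"
    by (subst sum.swap) (simp add: sum_distrib_right)
  also have "\<dots> = (1 - a) * norm1 \<xi>"
    by (simp add: sum_subtractf colsum norm1_def sum_distrib_left)
  finally show ?thesis .
qed

section \<open>Exponential decay of the evolution family\<close>

locale minorized_rate_family = bounded_rate_family Q \<Theta> q
  for Q :: "real ^ 'd \<Rightarrow> real ^ 'n ^ 'n" and \<Theta> q +
  fixes k :: 'n and q_low :: real
  assumes q_low_pos: "q_low > 0"
    and rate_to_k: "\<theta> \<in> \<Theta> \<Longrightarrow> i \<noteq> k \<Longrightarrow> q_low \<le> Q \<theta> $ i $ k"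
begin

abbreviation \<alpha> where "\<alpha> \<equiv> exp (- q / q_low)"

context
  fixes \<phi> :: "real \<Rightarrow> real ^ 'd" and \<delta> :: real
  assumes path: "measurable_path \<Theta> \<phi>" and \<delta>: "\<delta> > 0"
begin

text \<open>The time is chosen so that \<open>q_low * (t - s) / \<delta>\<close> equals 1. The
  bracket in \<open>evolution_matrix_entry_ge\<close> is then 1 in both cases, once from the initial
  entry and once from the inflow.\<close>

lemma evolution_matrix_minorization:
  assumes "0 \<le> s"
  shows "\<alpha> \<le> evolution_matrix Q \<delta> \<phi> (s + \<delta> / q_low) s $ k $ j"
proof (cases "j = k")
  case True
  have "0 \<le> Q \<theta> $ k $ k + q" if "\<theta> \<in> \<Theta>" for \<theta>
    using rate_matrix_diag_bound(2)[OF rates exit_rate_le, OF that that] .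
  then show ?thesis
    using evolution_matrix_entry_ge[OF path \<delta> assms, of "s + \<delta> / q_low" 0 k k j] \<delta> q_low_pos True
    by simp
next
  case False
  then show ?thesis
    using evolution_matrix_entry_ge[OF path \<delta> assms, of "s + \<delta> / q_low" q_low j k j] \<delta> q_low_pos
      rate_to_k[of _ j]
    by (simp add: axis_def)
qed

lemma evolution_matrix_zero_sum:
  assumes "0 \<le> s" "s \<le> t" "\<xi> \<in> zero_sum"
  shows "evolution_matrix Q \<delta> \<phi> t s *v \<xi> \<in> zero_sum"
  using assms by (intro zero_sum_mult evolution_matrix_column_sum[OF path \<delta>])

text \<open>The contraction with \<open>a = 0\<close>; it takes care of the time left over after the
  last full window.\<close>

lemma evolution_norm1_le:
  assumes "0 \<le> s" "s \<le> t" "\<xi> \<in> zero_sum"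
  shows "norm1 (evolution_matrix Q \<delta> \<phi> t s *v \<xi>) \<le> norm1 \<xi>"
  using doeblin_contraction[of "evolution_matrix Q \<delta> \<phi> t s" 0] assms
    evolution_matrix_nonneg[OF path \<delta>] evolution_matrix_column_sum[OF path \<delta>] by simp

text \<open>Windows are peeled off at the left end, so \<open>s\<close> and \<open>\<xi>\<close>
  vary in the induction; the base case is nonexpansiveness over the remaining time.
  \<open>q \<ge> 0\<close> makes \<open>1 - \<alpha>\<close> nonnegative, so that the bounds may be
  multiplied.\<close>

lemma evolution_norm1_iterate:
  assumes "0 \<le> s" "s + real n * (\<delta> / q_low) \<le> t" "\<xi> \<in> zero_sum" "q \<ge> 0"
  shows "norm1 (evolution_matrix Q \<delta> \<phi> t s *v \<xi>) \<le> (1 - \<alpha>) ^ n * norm1 \<xi>"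
  using assms
proof (induction n arbitrary: s \<xi>)
  case 0
  then show ?case using evolution_norm1_le by simp
next
  case (Suc n)
  let ?T = "\<delta> / q_low"
  let ?\<eta> = "evolution_matrix Q \<delta> \<phi> (s + ?T) s *v \<xi>"
  have T: "?T > 0" using \<delta> q_low_pos by simp
  have "s + real (Suc n) * ?T = s + ?T + real n * ?T" by (simp add: distrib_right add_divide_distrib)
  then have le: "s + ?T + real n * ?T \<le> t" using Suc.prems(2) by (simp only:)
  have nT: "0 \<le> real n * ?T" by (rule mult_nonneg_nonneg[OF of_nat_0_le_iff less_imp_le[OF T]])
  have \<eta>: "?\<eta> \<in> zero_sum" using Suc.prems T by (intro evolution_matrix_zero_sum) auto
  have "evolution_matrix Q \<delta> \<phi> t s *v \<xi> = evolution_matrix Q \<delta> \<phi> t (s + ?T) *v ?\<eta>"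
    using Suc.prems(1) T le nT
    by (subst evolution_matrix_comp[OF path \<delta>, of s "s + ?T" t]) (auto simp: matrix_vector_mul_assoc)
  then have "norm1 (evolution_matrix Q \<delta> \<phi> t s *v \<xi>) \<le> (1 - \<alpha>) ^ n * norm1 ?\<eta>"
    using Suc.IH[of "s + ?T" ?\<eta>] Suc.prems T le \<eta> by simp
  also have "\<dots> \<le> (1 - \<alpha>) ^ n * ((1 - \<alpha>) * norm1 \<xi>)"
  proof (rule mult_left_mono)
    show "norm1 ?\<eta> \<le> (1 - \<alpha>) * norm1 \<xi>"
      using Suc.prems T
      by (intro doeblin_contraction[where k = k] evolution_matrix_nonneg[OF path \<delta>]
          evolution_matrix_column_sum[OF path \<delta>] evolution_matrix_minorization) auto
    show "0 \<le> (1 - \<alpha>) ^ n" using \<open>q \<ge> 0\<close> q_low_pos by simp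
  qed
  finally show ?case by (simp add: mult_ac)
qed

text \<open>With x = (t - s) / T the number of full windows is n = floor x \<ge> x - 1. Hence
  \<open>(1 - \<alpha>) ^ n\<close> is at most the real power of \<open>1 - \<alpha>\<close> with
  exponent x - 1, and the missing factor becomes the prefactor. \<open>q > 0\<close> keeps
  \<open>1 - \<alpha>\<close> away from 0, so its logarithm makes sense.\<close>

lemma evolution_norm1_decay:
  assumes "0 \<le> s" "s \<le> t" "\<xi> \<in> zero_sum" "q > 0"
  shows "norm1 (evolution_matrix Q \<delta> \<phi> t s *v \<xi>)
    \<le> inverse (1 - \<alpha>) * exp (- (q_low * ln (1 / (1 - \<alpha>))) * (t - s) / \<delta>) * norm1 \<xi>"
proof -
  define T where "T = \<delta> / q_low"
  define x where "x = (t - s) / T"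
  define n where "n = nat \<lfloor>x\<rfloor>"
  define l where "l = ln (1 - \<alpha>)"
  have T: "T > 0" using \<delta> q_low_pos by (simp add: T_def)
  have \<alpha>: "0 < 1 - \<alpha>" "1 - \<alpha> < 1" using \<open>q > 0\<close> q_low_pos by simp_all
  then have l: "l < 0" "exp l = 1 - \<alpha>" by (simp_all add: l_def)
  have "x \<ge> 0" unfolding x_def using T assms by (intro divide_nonneg_pos) auto
  then have n: "real n \<le> x" "x - 1 \<le> real n" unfolding n_def by linarith+
  have "real n * T \<le> t - s"
    using n(1) T by (simp add: x_def pos_le_divide_eq)
  then have "norm1 (evolution_matrix Q \<delta> \<phi> t s *v \<xi>) \<le> (1 - \<alpha>) ^ n * norm1 \<xi>"
    using assms by (intro evolution_norm1_iterate) (auto simp: T_def)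
  also have "(1 - \<alpha>) ^ n \<le> inverse (1 - \<alpha>) * exp (- (q_low * ln (1 / (1 - \<alpha>))) * (t - s) / \<delta>)"
  proof -
    have "(1 - \<alpha>) ^ n = exp (real n * l)"
      by (simp only: l(2)[symmetric] exp_of_nat_mult)
    \<comment> \<open>\<open>l\<close> is negative, so multiplying by it reverses
      \<open>x - 1 \<le> real n\<close>.\<close>
    also have "\<dots> \<le> exp ((x - 1) * l)"
      using mult_right_mono_neg[OF n(2), of l] l(1) by simp
    also have "(x - 1) * l = - l + - (q_low * - l) * (t - s) / \<delta>"
      by (simp add: x_def T_def algebra_simps)
    also have "exp \<dots> = inverse (1 - \<alpha>) * exp (- (q_low * - l) * (t - s) / \<delta>)"
      by (simp only: exp_add exp_minus l(2))
    also have "- l = ln (1 / (1 - \<alpha>))"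
      using \<alpha>(1) ln_inverse[of "1 - \<alpha>"] by (simp only: l_def inverse_eq_divide)
    finally show ?thesis .
  qed
  finally show ?thesis using norm1_nonneg[of \<xi>] by (simp add: mult_right_mono)
qed

end

lemma path_bound_explicit:
  assumes "q > 0"
  shows "path_bound \<Theta> Q (inverse (1 - \<alpha>)) (q_low * ln (1 / (1 - \<alpha>)))"
proof -
  have \<alpha>: "0 < 1 - \<alpha>" "1 - \<alpha> < 1" using assms q_low_pos by simp_all
  then have "1 \<le> inverse (1 - \<alpha>)" "0 < q_low * ln (1 / (1 - \<alpha>))"
    using q_low_pos by (simp_all add: one_le_inverse)
  then show ?thesis
    unfolding path_bound_def evolution_zero_sum_def
    using evolution_matrix_zero_sum evolution_norm1_decay assms by auto
qed

text \<open>A frozen parameter is a constant path; with \<delta> = 1 and start time 0 its evolution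
  matrix acts as the matrix exponential, so the constants carry over unchanged.\<close>

lemma mixing_bound_if_path_bound:
  assumes "path_bound \<Theta> Q C \<gamma>"
  shows "mixing_bound \<Theta> Q C \<gamma>"
  unfolding mixing_bound_def
proof (intro conjI ballI allI impI)
  fix \<theta> and \<xi> :: "real ^ 'n" and t :: real assume \<theta>: "\<theta> \<in> \<Theta>" and \<xi>: "\<xi> \<in> zero_sum" and t: "0 \<le> t"
  have "measurable_path \<Theta> (\<lambda>_. \<theta>)" using \<theta> by (simp add: measurable_path_def)
  then have "norm1 (evolution_zero_sum Q 1 (\<lambda>_. \<theta>) t 0 \<xi>) \<le> C * exp (- \<gamma> * (t - 0) / 1) * norm1 \<xi>"
    using assms \<xi> t unfolding path_bound_def by (meson order_refl zero_less_one)
  then show "norm1 (matrix_exp (t *\<^sub>R transpose (Q \<theta>)) *v \<xi>) \<le> C * exp (- \<gamma> * t) * norm1 \<xi>"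
    unfolding matrix_exp_eq_evolution_matrix[OF \<theta> t] using \<xi> by (simp add: evolution_zero_sum_def)
qed (use assms in \<open>simp_all add: path_bound_def\<close>)

end

section \<open>The one-state case and the stability theorem\<close>

lemma zero_sum_singleton:
  assumes "CARD('n) = 1"
  shows "(zero_sum :: (real ^ 'n) set) = {0}"
proof -
  obtain a :: 'n where a: "UNIV = {a}" using assms card_1_singletonE by blast
  have "x = 0" if "x $ a = 0" for x :: "real ^ 'n"
    unfolding vec_eq_iff
  proof
    fix i
    have "i \<in> {a}" unfolding a[symmetric] by simp
    then show "x $ i = 0 $ i" using that by simp
  qed
  then show ?thesis unfolding zero_sum_def a by auto
qed

theorem proposition10:
  fixes Q :: "real ^ 'd \<Rightarrow> real ^ 'n ^ 'n"
    and \<Theta> :: "(real ^ 'd) set"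
    and k :: 'n
    and R q_low q_bar \<tau> \<alpha> :: real
  assumes "R > 0"
    and "\<Theta> = param_cube R"
    and "\<forall>\<theta>\<in>\<Theta>. rate_matrix (Q \<theta>)"
    and "\<exists>L>0. \<forall>\<theta>\<in>\<Theta>. \<forall>\<theta>'\<in>\<Theta>.
           opnorm1 (transpose (Q \<theta>) - transpose (Q \<theta>')) \<le> L * norm (\<theta> - \<theta>')"
    and "q_low > 0"
    and "\<forall>\<theta>\<in>\<Theta>. \<forall>i. i \<noteq> k \<longrightarrow> Q \<theta> $ i $ k \<ge> q_low"
    and "q_bar = max_exit_rate \<Theta> Q"
    and "\<tau> = inverse q_low"
    and "\<alpha> = exp (- q_bar / q_low)"
  shows "(\<forall>\<phi> \<delta> s. measurable_path \<Theta> \<phi> \<and> \<delta> > 0 \<and> s \<ge> 0 \<longrightarrow>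
            (\<forall>j i. column j (evolution_matrix Q \<delta> \<phi> (s + \<delta> * \<tau>) s) $ i
                     \<ge> (\<alpha> *\<^sub>R axis k 1) $ i))
       \<and> pathwise_stable \<Theta> Q
       \<and> (CARD('n) \<ge> 2 \<longrightarrow>
            path_bound \<Theta> Q (inverse (1 - \<alpha>)) (q_low * ln (1 / (1 - \<alpha>))))
       \<and> (CARD('n) = 1 \<longrightarrow> (zero_sum :: (real ^ 'n) set) = {0})"
proof -
  have compact: "compact \<Theta>" by (simp add: assms(2) param_cube_eq_cbox)
  obtain L where "L > 0" "\<And>\<theta> \<theta>'. \<theta> \<in> \<Theta> \<Longrightarrow> \<theta>' \<in> \<Theta> \<Longrightarrow>
      opnorm1 (transpose (Q \<theta>) - transpose (Q \<theta>')) \<le> L * norm (\<theta> - \<theta>')"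
    using assms(4) by blast
  then have cont: "continuous_on \<Theta> Q" by (intro continuous_on_opnorm1_lipschitz)
  interpret minorized_rate_family Q \<Theta> q_bar k q_low
  proof
    show "closed \<Theta>" using compact by (rule compact_imp_closed)
    show "(\<Sum>j\<in>UNIV - {i}. Q \<theta> $ i $ j) \<le> q_bar" if "\<theta> \<in> \<Theta>" for \<theta> i
      unfolding assms(7) using compact cont that by (rule exit_rate_le_max_exit_rate)
  qed (use cont assms(3,5,6) in auto)
  have T: "\<delta> * \<tau> = \<delta> / q_low" for \<delta> using assms(8) by (simp add: divide_inverse)
  have minor: "(\<alpha> *\<^sub>R axis k 1) $ i \<le> column j (evolution_matrix Q \<delta> \<phi> (s + \<delta> * \<tau>) s) $ i"
    if "measurable_path \<Theta> \<phi>" "\<delta> > 0" "s \<ge> 0" for \<phi> \<delta> s i j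
  proof (cases "i = k")
    case True
    then show ?thesis
      using evolution_matrix_minorization[OF that, of j] by (simp add: T column_def assms(9))
  next
    case False
    have "0 \<le> evolution_matrix Q \<delta> \<phi> (s + \<delta> / q_low) s $ i $ j"
      using that assms(5) by (intro evolution_matrix_nonneg) auto
    then show ?thesis using False by (simp add: T column_def axis_def)
  qed
  have bound: "path_bound \<Theta> Q (inverse (1 - \<alpha>)) (q_low * ln (1 / (1 - \<alpha>)))" if "CARD('n) \<ge> 2"
  proof -
    \<comment> \<open>A second state \<open>i\<close> must leave towards \<open>k\<close> at rate at
      least \<open>q_low\<close>, which forces \<open>q_bar > 0\<close> and thus \<alpha> < 1. With
      one state all exit rates are empty sums, \<alpha> would be 1 and the constants would
      degenerate.\<close>
    have "UNIV \<noteq> {k}"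
    proof
      assume "UNIV = {k}"
      then have "CARD('n) = card {k}" by (rule arg_cong)
      then show False using that by simp
    qed
    then obtain i where "i \<noteq> k" by blast
    \<comment> \<open>Any parameter would do; positivity of \<open>R\<close> puts the origin into
      the cube.\<close>
    have "0 \<in> \<Theta>" using assms(1,2) by (simp add: param_cube_def)
    then have "q_low \<le> Q 0 $ i $ k" using \<open>i \<noteq> k\<close> assms(6) by blast
    also have "\<dots> \<le> q_bar"
      using rate_matrix_diag_bound(1)[OF rates exit_rate_le, OF \<open>0 \<in> \<Theta>\<close> \<open>0 \<in> \<Theta>\<close>, of i k] by simp
    finally have "q_bar > 0" using assms(5) by simp
    then show ?thesis unfolding assms(9) by (rule path_bound_explicit)
  qed
  have zero: "(zero_sum :: (real ^ 'n) set) = {0}" if "CARD('n) = 1"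
    using that by (rule zero_sum_singleton)
  have "\<exists>C \<gamma>. path_bound \<Theta> Q C \<gamma>"
  proof (cases "CARD('n) = 1")
    case True
    have "norm1 (0 :: real ^ 'n) = 0" by (simp add: norm1_def)
    \<comment> \<open>On the zero space every admissible pair of constants works.\<close>
    then have "path_bound \<Theta> Q 1 1"
      unfolding path_bound_def evolution_zero_sum_def zero[OF True] by simp
    then show ?thesis by blast
  next
    case False
    have "CARD('n) > 0" by simp
    with False have "CARD('n) \<ge> 2" by linarith
    then show ?thesis using bound by blast
  qed
  then have "pathwise_stable \<Theta> Q"
    unfolding pathwise_stable_def using mixing_bound_if_path_bound by blast
  then show ?thesis using minor bound zero by blast
qed

end
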